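(* Let $\alpha,\beta>-1$, let $m$ be a positive integer and let $\mu\in\mathcal{P}_m(\alpha,\beta)$. Let $\{\zeta_n\}_{n>m}$ be a sequence of complex numbers with limit $\zeta\in\mathbb{C}\setminus[-1,1]$, and let $\{Q_n\}_{n>m}$ be the sequence of monic orthogonal polynomials with respect to the pair $(\mathcal{L}^{(\alpha,\beta)},\mu)$ such that $Q_n(\zeta_n)=0$. Then the accumulation points of the zeros of $\{Q_n\}_{n>m}$ are located on the set $E=\mathcal{E}(\zeta)\cup[-1,1]$, where $\mathcal{E}(\zeta)$ is the ellipse $$\mathcal{E}(\zeta)=\{z\in\mathbb{C}: z=\cosh(\eta_\zeta+i\theta),\ 0\le\theta<2\pi\},\qquad \eta_\zeta=\ln|\varphi(\zeta)|=\ln\left|\zeta+\sqrt{\zeta^2-1}\right|.$$ Moreover, if $\delta(\zeta)=\inf_{-1\le x\le 1}|\zeta-x|>2$, then one can take $E=\mathcal{E}(\zeta)$, i.e. the accumulation points of the zeros are located on $\mathcal{E}(\zeta)$.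
   Context: For $\alpha,\beta>-1$ let $d\mu_{\alpha,\beta}(x)=(1-x)^\alpha(1+x)^\beta dx$ on $[-1,1]$, let $$\mathcal{L}^{(\alpha,\beta)}[f]=(1-x^2)f''+(\beta-\alpha-(\alpha+\beta+2)x)f'$$ be the Jacobi differential operator on polynomials, and $\lambda_n=-n(1+n+\alpha+\beta)$. The class $\mathcal{P}_m(\alpha,\beta)$ consists of the finite positive Borel measures $\mu$ on $[-1,1]$ for which there is a polynomial $\rho$ of degree $m$, nonnegative on $[-1,1]$, with $d\mu(x)=\rho^{-1}(x)\,d\mu_{\alpha,\beta}(x)$. Let $L_n$ be the $n$th monic orthogonal polynomial with respect to $\mu$. For $\mu\in\mathcal{P}_m(\alpha,\beta)$ and each $n>m$ there is a monic polynomial $Q_n$ of degree $n$, unique up to an additive constant, such that $\int\mathcal{L}^{(\alpha,\beta)}[Q_n](x)\,x^k\,d\mu(x)=0$ for $0\le k\le n-1$; equivalently $\mathcal{L}^{(\alpha,\beta)}[Q_n]=\lambda_nL_n$. "The sequence of monic orthogonal polynomials with respect to $(\mathcal{L}^{(\alpha,\beta)},\mu)$ such that $Q_n(\zeta_n)=0$" means that the additive constant is fixed by $Q_n(\zeta_n)=0$. $\varphi(z)=z+\sqrt{z^2-1}$, with the branch of the square root for which $|\varphi(z)|>1$ on $\mathbb{C}\setminus[-1,1]$. A point $z\in\mathbb{C}$ is an accumulation point of the zeros of $\{Q_n\}_{n>m}$ if every neighborhood of $z$ contains a zero of $Q_n$ for infinitely many $n$. *)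

theory Defs
  imports "HOL-Analysis.Analysis" "HOL-Computational_Algebra.Polynomial"
begin

text \<open>
  Measures on the interval from -1 to 1 are represented as Borel measures on the real line
  that are concentrated on that interval. The value given to the weight at the two end points
  is irrelevant, these form a null set.
\<close>

definition jacobi_measure :: "real \<Rightarrow> real \<Rightarrow> real measure" where
  "jacobi_measure \<alpha> \<beta> =
     density lborel (\<lambda>x. ennreal (indicator {-1..1} x * ((1 - x) powr \<alpha> * (1 + x) powr \<beta>)))"

text \<open>
  The zeros of \<open>\<rho>\<close> are null for the Jacobi measure, so it does not matter that \<open>1 / 0 = 0\<close> here;
  finiteness of \<open>\<mu>\<close> restricts where \<open>\<rho>\<close> may vanish.
\<close>

definition jacobi_class :: "nat \<Rightarrow> real \<Rightarrow> real \<Rightarrow> real measure set" where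
  "jacobi_class m \<alpha> \<beta> =
     {\<mu>. finite_measure \<mu> \<and>
         (\<exists>\<rho> :: real poly. \<rho> \<noteq> 0 \<and> degree \<rho> = m \<and> (\<forall>x\<in>{-1..1}. poly \<rho> x \<ge> 0) \<and>
            \<mu> = density (jacobi_measure \<alpha> \<beta>) (\<lambda>x. ennreal (1 / poly \<rho> x)))}"

definition jacobi_op :: "real \<Rightarrow> real \<Rightarrow> complex poly \<Rightarrow> complex poly" where
  "jacobi_op \<alpha> \<beta> f =
     [:1, 0, -1:] * pderiv (pderiv f) +
     [:of_real (\<beta> - \<alpha>), - of_real (\<alpha> + \<beta> + 2):] * pderiv f"

text \<open>
  This determines \<open>q\<close> only up to an additive constant, which may be complex; hence complex
  coefficients.
\<close>

definition is_monic_orthogonal_wrt_op ::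
    "(complex poly \<Rightarrow> complex poly) \<Rightarrow> real measure \<Rightarrow> nat \<Rightarrow> complex poly \<Rightarrow> bool" where
  "is_monic_orthogonal_wrt_op L \<mu> n q \<longleftrightarrow>
     lead_coeff q = 1 \<and> degree q = n \<and>
     (\<forall>k<n. (\<integral>x. poly (L q) (of_real x) * of_real x ^ k \<partial>\<mu>) = 0)"

text \<open>Meaningful only off the real segment from -1 to 1, see \<open>sqrt_branch_unique\<close>.\<close>

definition sqrt_branch :: "complex \<Rightarrow> complex" where
  "sqrt_branch z = (THE s. s\<^sup>2 = z\<^sup>2 - 1 \<and> cmod (z + s) > 1)"

definition phi :: "complex \<Rightarrow> complex" where
  "phi z = z + sqrt_branch z"

lemma sqrt_branch_unique:
  assumes "z \<notin> complex_of_real ` {-1..1}"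
  shows "\<exists>!s. s\<^sup>2 = z\<^sup>2 - 1 \<and> cmod (z + s) > 1"
proof -
  define r where "r = csqrt (z\<^sup>2 - 1)"
  have r: "r\<^sup>2 = z\<^sup>2 - 1" by (simp add: r_def)
  have prod: "(z + r) * (z - r) = 1"
    using r by (simp add: algebra_simps power2_eq_square)
  then have nprod: "cmod (z + r) * cmod (z - r) = 1"
    by (metis norm_mult norm_one)
  have "cmod (z + r) \<noteq> 1"
  proof
    assume u: "cmod (z + r) = 1"
    have "(z + r) * cnj (z + r) = 1"
      using u complex_norm_square[of "z + r"] by simp
    then have "cnj (z + r) = z - r"
      using prod by (metis mult_cancel_left mult_zero_left zero_neq_one)
    then have "2 * z = complex_of_real (2 * Re (z + r))"
      using complex_add_cnj[of "z + r"] by simp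
    then have z: "z = complex_of_real (Re (z + r))"
      by (simp add: complex_eq_iff)
    have "\<bar>Re (z + r)\<bar> \<le> 1" using abs_Re_le_cmod[of "z + r"] u by simp
    then have "Re (z + r) \<in> {-1..1}" by (auto simp: abs_le_iff)
    with z assms show False by blast
  qed
  have ge: "b < 1" if "a * b = 1" "a > 1" for a b :: real
    using that by (smt (verit) mult_le_cancel_left1)
  from \<open>cmod (z + r) \<noteq> 1\<close> consider "cmod (z + r) > 1" | "cmod (z + r) < 1" by linarith
  then show ?thesis
  proof cases
    case 1
    then have "cmod (z - r) < 1" using nprod ge by blast
    with 1 r show ?thesis
      by (intro ex1I[of _ r]) (auto simp: power2_eq_iff simp flip: r)
  next
    case 2
    have "cmod (z - r) > 1"
    proof (rule ccontr)
      assume "\<not> ?thesis"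
      then have "cmod (z + r) * cmod (z - r) \<le> cmod (z + r) * 1"
        by (intro mult_left_mono) auto
      with 2 nprod show False by simp
    qed
    with 2 r show ?thesis
      by (intro ex1I[of _ "- r"]) (auto simp: power2_eq_iff simp flip: r)
  qed
qed

definition zeta_ellipse :: "complex \<Rightarrow> complex set" where
  "zeta_ellipse \<zeta> =
     {cosh (of_real (ln (cmod (phi \<zeta>))) + \<i> * of_real \<theta>) |\<theta>. 0 \<le> \<theta> \<and> \<theta> < 2 * pi}"

definition zero_accumulation_points :: "nat \<Rightarrow> (nat \<Rightarrow> complex poly) \<Rightarrow> complex set" where
  "zero_accumulation_points m Q =
     {z. \<forall>U. open U \<and> z \<in> U \<longrightarrow> infinite {n. n > m \<and> (\<exists>w\<in>U. poly (Q n) w = 0)}}"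

end

theory Submission
  imports Defs "HOL-Complex_Analysis.Complex_Analysis" "HOL-Real_Asymp.Real_Asymp"
begin

text \<open>
  Let \<open>P\<^sub>n\<close> be the monic Jacobi polynomials, which are the eigenfunctions of the differential operator,
  and \<open>L\<^sub>n\<close> the orthogonal polynomials for \<open>\<mu>\<close>. Since \<open>\<rho> P\<^sub>k\<close> is orthogonal to \<open>L\<^sub>n\<close> for \<open>k < n - m\<close>,
  \<open>L\<^sub>n\<close> is a combination of \<open>P\<^sub>n, \<dots>, P\<^sub>n\<^sub>-\<^sub>m\<close>, with coefficients that stay bounded because the
  recurrence coefficients \<open>\<gamma>\<^sub>n\<close> of the Jacobi polynomials tend to \<open>1/4\<close>. Inverting the operator
  multiplies the coefficients by \<open>\<lambda>\<^sub>n / \<lambda>\<^sub>n\<^sub>-\<^sub>j \<rightarrow> 1\<close>, so off the interval \<open>Q\<^sub>n\<close> is, up to a constant,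
  \<open>L\<^sub>n + o(P\<^sub>n)\<close>. As \<open>L\<^sub>n\<close> has no zeros off the interval, Montel's and Hurwitz's theorems bound
  \<open>L\<^sub>n / P\<^sub>n\<close> away from zero on compact sets. Under \<open>z = (w + 1/w) / 2\<close> with \<open>\<bar>w\<bar> < 1\<close> the ratios
  \<open>P\<^sub>n / P\<^sub>n\<^sub>+\<^sub>1\<close> tend to \<open>2 w\<close>, hence \<open>P\<^sub>n\<close> grows geometrically faster on an outer confocal ellipse
  than on an inner one. So a zero of \<open>Q\<^sub>n\<close>, that is a solution of \<open>Q\<^sub>n(z) = Q\<^sub>n(\<zeta>\<^sub>n)\<close>, must asymptotically
  lie on the ellipse through \<open>\<zeta>\<close>; points of the interval itself are excluded by the maximum principle.
\<close>

section \<open>Orthogonal polynomials for a measure on an interval\<close>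

text \<open>Phrased by coefficients rather than by \<open>degree\<close>, so that the zero
  polynomial qualifies for every \<open>n\<close> and \<open>n = 0\<close> admits nothing
  else.\<close>

abbreviation degree_less :: "complex poly \<Rightarrow> nat \<Rightarrow> bool" where
  "degree_less q n \<equiv> \<forall>i\<ge>n. coeff q i = 0"

abbreviation monic_of_degree :: "nat \<Rightarrow> complex poly \<Rightarrow> bool" where
  "monic_of_degree n p \<equiv> degree p = n \<and> coeff p n = 1"

text \<open>Subtracting \<open>coeff q n\<close> times \<open>P n\<close> removes the top
  coefficient, so induction on the degree bound applies.\<close>

lemma monic_expansion:
  assumes "\<And>k. k < n \<Longrightarrow> monic_of_degree k (P k)" and "degree_less q n"
  shows "\<exists>c. q = (\<Sum>k<n. smult (c k) (P k))"
  using assms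
proof (induction n arbitrary: q)
  case 0
  then show ?case by (simp add: poly_eq_iff)
next
  case (Suc n)
  define r where "r = q - smult (coeff q n) (P n)"
  have P: "degree (P n) = n" "coeff (P n) n = 1" using Suc.prems(1)[of n] by auto
  have "degree_less r n"
  proof (intro allI impI)
    fix i assume "i \<ge> n"
    then consider "i = n" | "i > n" "i \<ge> Suc n" by linarith
    then show "coeff r i = 0"
      using P Suc.prems(2) by cases (simp_all add: r_def coeff_eq_0)
  qed
  then obtain c where c: "r = (\<Sum>k<n. smult (c k) (P k))"
    using Suc.IH[OF _ \<open>degree_less r n\<close>] Suc.prems(1) less_SucI by blast
  have "q = (\<Sum>k<Suc n. smult ((c(n := coeff q n)) k) (P k))"
    using c by (simp add: r_def algebra_simps)
  then show ?case by blast
qed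

lemma degree_less_diff_monic:
  assumes "monic_of_degree n p" "monic_of_degree n q"
  shows "degree_less (p - q) n"
proof (intro allI impI)
  fix i assume "i \<ge> n"
  then consider "i = n" | "i > n" by linarith
  then show "coeff (p - q) i = 0"
    using assms by cases (auto simp: coeff_eq_0)
qed

text \<open>Concentration on a compact interval makes all continuous functions integrable and
  confines the zeros of orthogonal polynomials. Not being carried by a finite set makes the inner
  product positive definite on polynomials.\<close>

locale interval_measure = finite_measure M for M :: "real measure" +
  assumes sets_M: "sets M = sets borel"
    and AE_interval: "AE x in M. x \<in> {-1..1}"
    and infinite_support: "\<And>A. finite A \<Longrightarrow> \<not> (AE x in M. x \<in> A)"
begin

lemma integrable_continuous:
  fixes f :: "real \<Rightarrow> 'b::{banach, second_countable_topology}"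
  assumes "continuous_on UNIV f"
  shows "integrable M f"
proof -
  have "compact (f ` {-1..1})"
    using assms by (intro compact_continuous_image) (auto intro: continuous_on_subset)
  then obtain B where B: "\<And>x. x \<in> {-1..1} \<Longrightarrow> norm (f x) \<le> B"
    using compact_imp_bounded bounded_iff by (metis image_eqI)
  have "f \<in> borel_measurable M"
    using borel_measurable_continuous_onI[OF assms] sets_M by (simp cong: measurable_cong_sets)
  moreover have "AE x in M. norm (f x) \<le> B"
    using AE_interval B by auto
  ultimately show ?thesis by (rule integrable_const_bound[rotated])
qed

section \<open>Hermitian inner product and orthogonality\<close>

definition ip :: "complex poly \<Rightarrow> complex poly \<Rightarrow> complex" where
  "ip p q = (\<integral>x. poly p (of_real x) * cnj (poly q (of_real x)) \<partial>M)"

definition nsq :: "complex poly \<Rightarrow> real" where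
  "nsq p = (\<integral>x. (cmod (poly p (of_real x)))\<^sup>2 \<partial>M)"

definition orth :: "nat \<Rightarrow> complex poly \<Rightarrow> bool" where
  "orth n p \<longleftrightarrow> (\<forall>q. degree_less q n \<longrightarrow> ip p q = 0)"

lemma integrable_ip [simp, intro]:
  "integrable M (\<lambda>x. poly p (of_real x) * cnj (poly q (of_real x)))"
  by (intro integrable_continuous continuous_intros)

lemma integrable_nsq [simp, intro]: "integrable M (\<lambda>x. (cmod (poly p (of_real x)))\<^sup>2)"
  by (intro integrable_continuous continuous_intros)

lemma ip_add_left: "ip (p + q) r = ip p r + ip q r"
  by (simp add: ip_def ring_distribs)

lemma ip_diff_left: "ip (p - q) r = ip p r - ip q r"
  by (simp add: ip_def ring_distribs)

lemma ip_smult_left: "ip (smult c p) r = c * ip p r"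
  by (simp add: ip_def mult.assoc)

lemma ip_commute: "ip q p = cnj (ip p q)"
  by (simp add: ip_def mult.commute flip: Bochner_Integration.integral_cnj)

lemma ip_0_left [simp]: "ip 0 p = 0"
  by (simp add: ip_def)

lemma ip_sum_left: "ip (\<Sum>k\<in>A. f k) r = (\<Sum>k\<in>A. ip (f k) r)"
  by (induction A rule: infinite_finite_induct) (auto simp: ip_add_left)

lemma ip_add_right: "ip r (p + q) = ip r p + ip r q"
  by (metis ip_commute ip_add_left complex_cnj_add)

lemma ip_diff_right: "ip r (p - q) = ip r p - ip r q"
  by (metis ip_commute ip_diff_left complex_cnj_diff)

lemma ip_smult_right: "ip r (smult c p) = cnj c * ip r p"
  by (metis ip_commute ip_smult_left complex_cnj_mult)

lemma ip_sum_right: "ip r (\<Sum>k\<in>A. f k) = (\<Sum>k\<in>A. ip r (f k))"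
  by (induction A rule: infinite_finite_induct) (auto simp: ip_add_right ip_commute[of r 0])

lemma ip_pCons_0: "ip (pCons 0 p) q = ip p (pCons 0 q)"
  by (simp add: ip_def mult_ac)

lemma ip_self: "ip p p = of_real (nsq p)"
  unfolding ip_def nsq_def integral_complex_of_real[symmetric]
  by (intro Bochner_Integration.integral_cong) (simp_all add: complex_norm_square del: of_real_power)

lemma nsq_nonneg: "nsq p \<ge> 0"
  by (simp add: nsq_def)

text \<open>A polynomial of norm zero vanishes almost everywhere, so the measure would be carried by
  its finitely many real roots.\<close>

lemma nsq_pos:
  assumes "p \<noteq> 0"
  shows "nsq p > 0"
proof (rule ccontr)
  assume "\<not> nsq p > 0"
  then have "nsq p = 0" using nsq_nonneg[of p] by simp
  then have "AE x in M. (cmod (poly p (of_real x)))\<^sup>2 = 0"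
    unfolding nsq_def by (subst (asm) integral_nonneg_eq_0_iff_AE) auto
  then have "AE x in M. x \<in> {x. poly p (of_real x) = 0}" by simp
  moreover have "finite {x::real. poly p (of_real x) = 0}"
    using finite_vimageI[OF poly_roots_finite[OF assms], of complex_of_real]
    by (simp add: vimage_def inj_of_real)
  ultimately show False using infinite_support by blast
qed

lemma nsq_eq_0_iff: "nsq p = 0 \<longleftrightarrow> p = 0"
  using nsq_pos[of p] by (cases "p = 0") (auto simp: nsq_def)

lemma orthD: "orth n p \<Longrightarrow> degree_less q n \<Longrightarrow> ip p q = 0"
  by (auto simp: orth_def)

lemma orthD': "orth n p \<Longrightarrow> degree_less q n \<Longrightarrow> ip q p = 0"
  by (subst ip_commute) (auto simp: orth_def)

text \<open>Links Hermitian orthogonality with the moment conditions of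
  \<open>is_monic_orthogonal_wrt_op\<close>. Powers are real on the real line, so the conjugation in
  \<open>ip\<close> does not affect them.\<close>

lemma orth_iff_powers:
  "orth n p \<longleftrightarrow> (\<forall>k<n. (\<integral>x. poly p (of_real x) * of_real x ^ k \<partial>M) = 0)"
proof -
  have ip_monom: "ip p (monom 1 k) = (\<integral>x. poly p (of_real x) * of_real x ^ k \<partial>M)" for k
    by (simp add: ip_def poly_monom)
  show ?thesis
  proof
    assume "orth n p"
    then show "\<forall>k<n. (\<integral>x. poly p (of_real x) * of_real x ^ k \<partial>M) = 0"
      by (auto simp: orth_def simp flip: ip_monom)
  next
    assume *: "\<forall>k<n. (\<integral>x. poly p (of_real x) * of_real x ^ k \<partial>M) = 0"
    show "orth n p"
      unfolding orth_def
    proof (intro allI impI)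
      fix q :: "complex poly" assume "degree_less q n"
      then obtain c where "q = (\<Sum>k<n. smult (c k) (monom 1 k))"
        using monic_expansion[of n "monom 1" q] by (auto simp: degree_monom_eq)
      then show "ip p q = 0"
        using * by (simp only: ip_sum_right ip_smult_right ip_monom) simp
    qed
  qed
qed

text \<open>Pythagoras: the leading terms cancel in \<open>q - p\<close>, which is therefore
  orthogonal to \<open>p\<close>. Hence \<open>p\<close> has least norm among the monic polynomials
  of its degree.\<close>

lemma nsq_monic:
  assumes "orth n p" "monic_of_degree n p" "monic_of_degree n q"
  shows "nsq q = nsq p + nsq (q - p)"
proof -
  have "ip p (q - p) = 0" "ip (q - p) p = 0"
    using degree_less_diff_monic[OF assms(3,2)] assms(1) orthD orthD' by blast+
  then have "ip q q = ip p p + ip (q - p) (q - p)"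
    by (simp add: ip_diff_left ip_diff_right)
  then show ?thesis by (simp add: ip_self flip: of_real_add)
qed

lemma nsq_monic_le:
  assumes "orth n p" "monic_of_degree n p" "monic_of_degree n q"
  shows "nsq p \<le> nsq q"
  using nsq_monic[OF assms] nsq_nonneg[of "q - p"] by simp

text \<open>Gram-Schmidt: \<open>s\<close> is the projection of the monomial onto the span of the
  polynomials already constructed.\<close>

lemma ex_orthogonal: "\<exists>p. monic_of_degree n p \<and> orth n p"
proof (induction n rule: less_induct)
  case (less n)
  then obtain P where P: "\<And>k. k < n \<Longrightarrow> monic_of_degree k (P k) \<and> orth k (P k)"
    by metis
  define s where "s = (\<Sum>k<n. smult (ip (monom 1 n) (P k) / of_real (nsq (P k))) (P k))"
  define p where "p = monom 1 n - s"
  have s: "degree_less s n"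
    using P by (auto simp: s_def coeff_sum coeff_eq_0)
  have cp: "coeff p i = (if i = n then 1 else 0)" if "i \<ge> n" for i
    using s that by (simp add: p_def)
  then have "degree p = n"
    by (intro antisym degree_le le_degree) auto
  with cp have "monic_of_degree n p" by auto
  moreover have ipP: "ip p (P j) = 0" if "j < n" for j
  proof -
    have nz: "nsq (P j) \<noteq> 0"
      using P[OF that] by (auto simp: nsq_eq_0_iff)
    have orth0: "ip (P k) (P j) = 0" if "k \<noteq> j" "k < n" for k
    proof (cases "k < j")
      case True
      then show ?thesis using P[OF that(2)]
        P[OF \<open>j < n\<close>] True
        by (intro orthD'[of j]) (auto simp: coeff_eq_0)
    next
      case False
      then show ?thesis using P[OF \<open>j < n\<close>] that
        by (intro orthD[of k]) (auto simp: P[OF that(2)] coeff_eq_0)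
    qed
    have "ip s (P j) = (\<Sum>k<n. if k = j then ip (monom 1 n) (P j) else 0)"
      unfolding s_def ip_sum_left using nz orth0
      by (intro sum.cong) (auto simp: ip_smult_left ip_self)
    also have "\<dots> = ip (monom 1 n) (P j)"
      using that by simp
    finally show ?thesis by (simp add: p_def ip_diff_left)
  qed
  moreover have "orth n p"
    unfolding orth_def
  proof (intro allI impI)
    fix q :: "complex poly" assume "degree_less q n"
    then obtain c where "q = (\<Sum>k<n. smult (c k) (P k))"
      using monic_expansion[OF _ \<open>degree_less q n\<close>] P by blast
    then show "ip p q = 0" by (simp add: ip_sum_right ip_smult_right ipP)
  qed
  ultimately show ?case by blast
qed

section \<open>The monic orthogonal polynomials, their zeros and their growth\<close>

definition monic_op :: "nat \<Rightarrow> complex poly" where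
  "monic_op n = (SOME p. monic_of_degree n p \<and> orth n p)"

lemma monic_op: "degree (monic_op n) = n" "coeff (monic_op n) n = 1" "orth n (monic_op n)"
  using someI_ex[OF ex_orthogonal[of n]] by (auto simp: monic_op_def)

lemma coeff_monic_op_eq_0: "i > n \<Longrightarrow> coeff (monic_op n) i = 0"
  using monic_op(1)[of n] by (simp add: coeff_eq_0)

lemma monic_op_nonzero [simp]: "monic_op n \<noteq> 0"
  using monic_op(2)[of n] by auto

lemma ip_monic_op: "ip (monic_op j) (monic_op k) = (if j = k then of_real (nsq (monic_op k)) else 0)"
proof -
  consider "j = k" | "k < j" | "j < k" by linarith
  then show ?thesis
  proof cases
    case 2
    then show ?thesis by (auto intro!: orthD[OF monic_op(3)] simp: coeff_monic_op_eq_0)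
  next
    case 3
    then show ?thesis by (auto intro!: orthD'[OF monic_op(3)] simp: coeff_monic_op_eq_0)
  qed (simp add: ip_self)
qed

text \<open>Normalised by \<open>nsq q\<close>, the density |q|^2 turns \<open>M\<close> into a
  probability measure on [-1,1]. The point \<open>y\<close> is its mean, which lies in the interval
  by convexity.\<close>

lemma ip_linear_factor:
  assumes "q \<noteq> 0"
  obtains y where "y \<in> {-1..1}" "ip ([:-z, 1:] * q) q = of_real (nsq q) * (of_real y - z)"
proof
  define I where "I = (\<integral>x. x * (cmod (poly q (of_real x)))\<^sup>2 \<partial>M)"
  have int: "integrable M (\<lambda>x. x * (cmod (poly q (of_real x)))\<^sup>2)"
    by (intro integrable_continuous continuous_intros)
  have nq: "nsq q > 0" by (rule nsq_pos[OF assms])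
  have "AE x in M. x * (cmod (poly q (of_real x)))\<^sup>2 \<le> (cmod (poly q (of_real x)))\<^sup>2"
    using AE_interval by eventually_elim (metis atLeastAtMost_iff mult_1 mult_right_mono zero_le_power2)
  then have "I \<le> nsq q"
    unfolding I_def nsq_def by (intro integral_mono_AE int integrable_nsq)
  moreover have "AE x in M. - ((cmod (poly q (of_real x)))\<^sup>2) \<le> x * (cmod (poly q (of_real x)))\<^sup>2"
    using AE_interval by eventually_elim (metis atLeastAtMost_iff mult_minus1 mult_right_mono zero_le_power2)
  then have "(\<integral>x. - ((cmod (poly q (of_real x)))\<^sup>2) \<partial>M) \<le> I"
    unfolding I_def by (intro integral_mono_AE int Bochner_Integration.integrable_minus integrable_nsq)
  ultimately have "I \<le> nsq q" "- nsq q \<le> I" by (simp_all add: nsq_def)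
  then show "I / nsq q \<in> {-1..1}" using nq by (auto simp: field_simps)
  have "ip ([:0, 1:] * q) q = (\<integral>x. complex_of_real (x * (cmod (poly q (of_real x)))\<^sup>2) \<partial>M)"
    unfolding ip_def by (intro Bochner_Integration.integral_cong) (simp_all add: complex_norm_square[symmetric] mult.assoc flip: of_real_power)
  also have "\<dots> = of_real I" unfolding I_def by (rule integral_complex_of_real)
  finally have "ip ([:0, 1:] * q) q = of_real I" .
  moreover have "[:-z, 1:] * q = [:0, 1:] * q - smult z q" by simp
  ultimately have eq: "ip ([:-z, 1:] * q) q = of_real I - z * of_real (nsq q)"
    by (simp only: ip_diff_left ip_smult_left ip_self)
  show "ip ([:-z, 1:] * q) q = of_real (nsq q) * (of_real (I / nsq q) - z)"
    unfolding eq using nq by (simp add: field_simps)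
qed

lemma monic_linear_factor:
  assumes "monic_of_degree (Suc n) p" "poly p z = 0"
  obtains q where "p = [:-z, 1:] * q" "monic_of_degree n q"
proof -
  obtain q where q: "p = [:-z, 1:] * q"
    using assms(2) poly_eq_0_iff_dvd by (auto simp: dvd_def)
  then have "lead_coeff q = 1"
    using assms(1) lead_coeff_mult[of "[:-z, 1:]" q] by (simp del: mult_pCons_left)
  moreover have "q \<noteq> 0" using calculation by auto
  then have "degree p = Suc (degree q)"
    using q by (simp add: degree_mult_eq del: mult_pCons_left)
  ultimately show ?thesis using that q assms by simp
qed

text \<open>With p = (X - z) q, orthogonality of \<open>p\<close> to \<open>q\<close> and
  \<open>ip_linear_factor\<close> force z to equal the mean \<open>y\<close>.\<close>

lemma zeros_in_interval:
  assumes "monic_of_degree n p" "orth n p" "n > 0" "poly p z = 0"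
  shows "z \<in> complex_of_real ` {-1..1}"
proof -
  obtain k where k: "n = Suc k" using assms(3) by (cases n) auto
  obtain q where q: "p = [:-z, 1:] * q" "monic_of_degree k q"
    using monic_linear_factor[OF assms(1)[unfolded k] assms(4)] by blast
  have "q \<noteq> 0" using q by auto
  then obtain y where y: "y \<in> {-1..1}" "ip p q = of_real (nsq q) * (of_real y - z)"
    using ip_linear_factor[of q z] q(1) by metis
  have "ip p q = 0" using q k by (intro orthD[OF assms(2)]) (auto simp: coeff_eq_0)
  then have "z = of_real y" using y nsq_pos[OF \<open>q \<noteq> 0\<close>] by simp
  then show ?thesis using y by blast
qed

text \<open>
  With \<open>t = p\<^sub>n\<^sub>+\<^sub>1(z) / p\<^sub>n(z)\<close> the polynomial \<open>p\<^sub>n\<^sub>+\<^sub>1 - t p\<^sub>n\<close> has the form \<open>(X - z) q\<close>; test it against \<open>q\<close>.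
\<close>

lemma monic_op_growth:
  assumes "\<And>x. x \<in> {-1..1} \<Longrightarrow> d \<le> cmod (z - of_real x)" "d > 0"
  shows "d * cmod (poly (monic_op n) z) \<le> cmod (poly (monic_op (Suc n)) z)"
proof -
  have z: "z \<notin> complex_of_real ` {-1..1}"
    using assms by force
  define p where "p = monic_op n"
  have pz: "poly p z \<noteq> 0"
  proof (cases "n = 0")
    case True
    then obtain c where "p = [:c:]" using monic_op(1)[of n] by (auto simp: p_def elim: degree_eq_zeroE)
    then show ?thesis using monic_op_nonzero[of n] by (auto simp: p_def)
  next
    case False
    then show ?thesis using z zeros_in_interval[of p n z] monic_op[of n] by (auto simp: p_def)
  qed
  define t where "t = poly (monic_op (Suc n)) z / poly p z"
  define g where "g = monic_op (Suc n) - smult t p"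
  have cg: "coeff g i = (if i = Suc n then 1 else 0)" if "i \<ge> Suc n" for i
    using that by (auto simp: g_def p_def monic_op(2) coeff_monic_op_eq_0)
  then have "degree g = Suc n" by (intro antisym degree_le le_degree) auto
  then have "monic_of_degree (Suc n) g" using cg by auto
  moreover have "poly g z = 0" using pz by (simp add: g_def t_def)
  ultimately obtain q where q: "g = [:-z, 1:] * q" "monic_of_degree n q"
    using monic_linear_factor by blast
  then have "q \<noteq> 0" by auto
  then obtain y where y: "y \<in> {-1..1}" "ip g q = of_real (nsq q) * (of_real y - z)"
    using ip_linear_factor[of q z] q(1) by metis
  have "ip (monic_op (Suc n)) q = 0"
    using q by (intro orthD[OF monic_op(3)]) (auto simp: coeff_eq_0)
  moreover have "ip p q = of_real (nsq p)"
  proof -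
    have "ip p (q - p) = 0" unfolding p_def
      by (intro orthD[OF monic_op(3)] degree_less_diff_monic) (use q monic_op in auto)
    then show ?thesis by (simp add: ip_diff_right ip_self)
  qed
  ultimately have "ip g q = - t * of_real (nsq p)"
    by (simp add: g_def ip_diff_left ip_smult_left)
  then have "t * of_real (nsq p) = of_real (nsq q) * (z - of_real y)"
    using y(2) by (simp add: algebra_simps)
  then have "cmod t * nsq p = nsq q * cmod (z - of_real y)"
    by (metis norm_mult norm_of_real abs_of_nonneg nsq_nonneg)
  \<comment> \<open>Extremality enters here: \<open>q\<close> is monic of degree \<open>n\<close>,
    so its norm is at least that of \<open>p\<close>.\<close>
  also have "\<dots> \<ge> nsq p * d"
    using assms(1)[OF y(1)] assms(2) nsq_monic_le[of n p q] q monic_op[of n] nsq_nonneg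
    by (intro mult_mono) (auto simp: p_def)
  finally have "nsq p * d \<le> nsq p * cmod t" by (simp add: mult.commute)
  then have "d \<le> cmod t"
    using nsq_pos[of p] by (simp add: p_def)
  then show ?thesis using pz by (simp add: t_def p_def norm_divide field_simps)
qed

end

section \<open>The Jacobi operator and the Jacobi polynomials\<close>

text \<open>The operator is triangular on the monomials, with the eigenvalues on the diagonal.
  Degrees, leading coefficients and the explicit coefficients of the Jacobi polynomials are all read
  off from this formula.\<close>

lemma coeff_jacobi_op:
  "coeff (jacobi_op \<alpha> \<beta> p) k =
     - of_real (real k * (1 + real k + \<alpha> + \<beta>)) * coeff p k
     + of_real ((real k + 1) * (\<beta> - \<alpha>)) * coeff p (Suc k)
     + of_real ((real k + 1) * (real k + 2)) * coeff p (Suc (Suc k))"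
proof -
  consider "k = 0" | "k = 1" | j where "k = Suc (Suc j)"
    by (metis One_nat_def nat.exhaust)
  then show ?thesis
    by cases (simp_all add: jacobi_op_def coeff_pderiv algebra_simps numeral_2_eq_2)
qed

lemma jacobi_op_diff: "jacobi_op \<alpha> \<beta> (p - q) = jacobi_op \<alpha> \<beta> p - jacobi_op \<alpha> \<beta> q"
  unfolding jacobi_op_def pderiv_diff by (simp only: algebra_simps)

lemma jacobi_op_smult: "jacobi_op \<alpha> \<beta> (smult c p) = smult c (jacobi_op \<alpha> \<beta> p)"
  unfolding jacobi_op_def by (simp only: pderiv_smult smult_add_right mult_smult_right)

lemma jacobi_op_0: "jacobi_op \<alpha> \<beta> 0 = 0"
  by (simp add: jacobi_op_def)

lemma jacobi_op_add: "jacobi_op \<alpha> \<beta> (p + q) = jacobi_op \<alpha> \<beta> p + jacobi_op \<alpha> \<beta> q"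
  unfolding jacobi_op_def pderiv_add by (simp only: algebra_simps)

lemma jacobi_op_sum: "jacobi_op \<alpha> \<beta> (\<Sum>k\<in>A. f k) = (\<Sum>k\<in>A. jacobi_op \<alpha> \<beta> (f k))"
  by (induction A rule: infinite_finite_induct) (auto simp: jacobi_op_0 jacobi_op_add)

lemma jacobi_eigenvalue_pos:
  assumes "\<alpha> > -1" "\<beta> > -1" "n > 0"
  shows "real n * (1 + real n + \<alpha> + \<beta>) > 0"
proof -
  have "1 + real n + \<alpha> + \<beta> > 0" using assms by (cases n) auto
  then show ?thesis using assms by simp
qed

text \<open>In positive degree the leading coefficient is multiplied by a nonzero eigenvalue. This
  is the uniqueness of the solutions \<open>Q n\<close> up to an additive constant.\<close>

lemma jacobi_op_eq_0_imp_const: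
  assumes "\<alpha> > -1" "\<beta> > -1" "jacobi_op \<alpha> \<beta> p = 0"
  shows "degree p = 0"
proof (rule ccontr)
  assume "degree p \<noteq> 0"
  then have "real (degree p) * (1 + real (degree p) + \<alpha> + \<beta>) \<noteq> 0" "lead_coeff p \<noteq> 0"
    using jacobi_eigenvalue_pos[OF assms(1,2), of "degree p"] by auto
  moreover have "coeff (jacobi_op \<alpha> \<beta> p) (degree p) = 0" using assms by simp
  ultimately show False
    unfolding coeff_jacobi_op by (simp add: coeff_eq_0 del: of_real_mult)
qed

section \<open>The Jacobi measure and its null sets\<close>

lemma sets_jacobi [simp]: "sets (jacobi_measure \<alpha> \<beta>) = sets borel"
  and space_jacobi [simp]: "space (jacobi_measure \<alpha> \<beta>) = UNIV"
  by (simp_all add: jacobi_measure_def)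

lemma AE_jacobi_iff:
  assumes [measurable]: "Measurable.pred borel P"
  shows "(AE x in jacobi_measure \<alpha> \<beta>. P x) \<longleftrightarrow> (AE x in lborel. x \<in> {-1<..<1} \<longrightarrow> P x)"
proof -
  have "(AE x in jacobi_measure \<alpha> \<beta>. P x) \<longleftrightarrow>
     (AE x in lborel. 0 < indicator {-1..1} x * ((1 - x) powr \<alpha> * (1 + x) powr \<beta>) \<longrightarrow> P x)"
    unfolding jacobi_measure_def by (subst AE_density) auto
  also have "\<dots> \<longleftrightarrow> (AE x in lborel. x \<in> {-1<..<1} \<longrightarrow> P x)"
  proof -
    \<comment> \<open>At the end points the weight takes the value 0 even for negative exponents,
      because \<open>0 powr c = 0\<close>.\<close>
    have "0 < indicator {-1..1} x * ((1 - x) powr \<alpha> * (1 + x) powr \<beta>) \<longleftrightarrow> x \<in> {-1<..<1}" for x :: real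
      by (cases "x = 1"; cases "x = -1"; cases "x \<in> {-1<..<1}") (auto simp: indicator_def)
    then show ?thesis by simp
  qed
  finally show ?thesis .
qed

lemma AE_jacobi_finite:
  assumes "finite A"
  shows "AE x in jacobi_measure \<alpha> \<beta>. x \<notin> A"
proof -
  have "A \<in> sets borel" using assms by (simp add: borel_closed finite_imp_closed)
  moreover have "AE x in lborel. x \<notin> A"
    by (rule AE_not_in) (rule finite_imp_null_set_lborel[OF assms])
  ultimately show ?thesis
    by (subst AE_jacobi_iff) auto
qed

lemma AE_jacobi_interval: "AE x in jacobi_measure \<alpha> \<beta>. x \<in> {-1..1}"
  by (subst AE_jacobi_iff) auto

lemma not_AE_jacobi_finite:
  assumes "finite A"
  shows "\<not> (AE x in jacobi_measure \<alpha> \<beta>. x \<in> A)"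
proof
  assume "AE x in jacobi_measure \<alpha> \<beta>. x \<in> A"
  with AE_jacobi_finite[OF assms] have "AE x in jacobi_measure \<alpha> \<beta>. False" by auto
  then have "AE x in lborel. x \<notin> {-1<..<1::real}" by (subst (asm) AE_jacobi_iff) auto
  then have "emeasure lborel {-1<..<1::real} = 0"
    by (subst (asm) AE_iff_measurable[of "{-1<..<1}"]) auto
  then show False by simp
qed

text \<open>The integrand is the derivative of (1-x)^(\<alpha>+1) (1+x)^(\<beta>+1) r(x), which
  vanishes at both end points since both exponents are positive.\<close>

lemma has_integral_jacobi:
  assumes "\<alpha> > -1" "\<beta> > -1"
  shows "((\<lambda>x. of_real ((1 - x) powr \<alpha> * (1 + x) powr \<beta>) *
     poly ([:1, 0, -1:] * pderiv r + [:of_real (\<beta> - \<alpha>), - of_real (\<alpha> + \<beta> + 2):] * r) (complex_of_real x))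
     has_integral 0) {-1..1}"
proof -
  let ?f = "\<lambda>x. of_real ((1 - x) powr (\<alpha> + 1) * (1 + x) powr (\<beta> + 1)) * poly r (complex_of_real x)"
  let ?g = "\<lambda>x. of_real ((1 - x) powr \<alpha> * (1 + x) powr \<beta>) *
     poly ([:1, 0, -1:] * pderiv r + [:of_real (\<beta> - \<alpha>), - of_real (\<alpha> + \<beta> + 2):] * r) (complex_of_real x)"
  have "(?g has_integral (?f 1 - ?f (-1))) {-1..1}"
  \<comment> \<open>For exponents between 0 and 1 the antiderivative is continuous but not
    necessarily differentiable at the end points, hence the version with derivatives in the interior
    only.\<close>
  proof (rule fundamental_theorem_of_calculus_interior)
    show "continuous_on {-1..1} ?f"
      using assms by (intro continuous_intros continuous_on_powr') auto
    fix x :: real assume x: "x \<in> {-1<..<1}"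
    have 1: "((\<lambda>x. (1 - x) powr (\<alpha> + 1) * (1 + x) powr (\<beta> + 1)) has_real_derivative
        (1 - x) powr \<alpha> * (1 + x) powr \<beta> * (\<beta> - \<alpha> - (\<alpha> + \<beta> + 2) * x)) (at x)"
    proof -
      have d1: "((\<lambda>x. (1 - x) powr (\<alpha> + 1)) has_real_derivative (\<alpha> + 1) * (1 - x) powr \<alpha> * (-1)) (at x)"
        using DERIV_fun_powr[of "\<lambda>x. 1 - x" "-1" x "\<alpha> + 1"] x
        by (auto intro!: derivative_eq_intros)
      have d2: "((\<lambda>x. (1 + x) powr (\<beta> + 1)) has_real_derivative (\<beta> + 1) * (1 + x) powr \<beta> * 1) (at x)"
        using DERIV_fun_powr[of "\<lambda>x. 1 + x" 1 x "\<beta> + 1"] x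
        by (auto intro!: derivative_eq_intros)
      show ?thesis
        using DERIV_mult[OF d1 d2] x by (simp add: powr_add algebra_simps)
    qed
    have 2: "((\<lambda>x. poly r (complex_of_real x)) has_vector_derivative poly (pderiv r) (of_real x)) (at x)"
      by (rule has_vector_derivative_real_field) (rule poly_DERIV)
    have "(?f has_vector_derivative
       of_real ((1 - x) powr (\<alpha> + 1) * (1 + x) powr (\<beta> + 1)) * poly (pderiv r) (of_real x)
       + of_real ((1 - x) powr \<alpha> * (1 + x) powr \<beta> * (\<beta> - \<alpha> - (\<alpha> + \<beta> + 2) * x)) * poly r (of_real x)) (at x)"
      by (intro has_vector_derivative_mult has_vector_derivative_of_real 1 2)
    also have "of_real ((1 - x) powr (\<alpha> + 1) * (1 + x) powr (\<beta> + 1)) * poly (pderiv r) (of_real x)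
       + of_real ((1 - x) powr \<alpha> * (1 + x) powr \<beta> * (\<beta> - \<alpha> - (\<alpha> + \<beta> + 2) * x)) * poly r (of_real x) = ?g x"
      using x by (simp add: powr_add algebra_simps)
    finally show "(?f has_vector_derivative ?g x) (at x)" .
  qed simp
  then show ?thesis using assms by simp
qed

lemma poly_map_cnj: "poly (map_poly cnj p) (complex_of_real x) = cnj (poly p (of_real x))"
  by (induction p) (auto simp: map_poly_pCons)

text \<open>Finiteness of the Jacobi measure is an assumption here, which avoids evaluating a Beta
  integral. It is later derived from the finiteness of \<mu>, see
  \<open>finite_\<nu>\<close>.\<close>

locale jacobi =
  fixes \<alpha> \<beta> :: real
  assumes \<alpha>: "\<alpha> > -1" and \<beta>: "\<beta> > -1"
    and finite_jacobi: "finite_measure (jacobi_measure \<alpha> \<beta>)"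
begin

sublocale interval_measure "jacobi_measure \<alpha> \<beta>"
  by (rule interval_measure.intro[OF finite_jacobi], unfold_locales)
     (auto simp: AE_jacobi_interval[simplified] not_AE_jacobi_finite)

lemma integral_jacobi_0:
  "(\<integral>x. poly ([:1, 0, -1:] * pderiv r + [:of_real (\<beta> - \<alpha>), - of_real (\<alpha> + \<beta> + 2):] * r)
      (complex_of_real x) \<partial>jacobi_measure \<alpha> \<beta>) = 0"
proof -
  define q where "q = [:1, 0, -1:] * pderiv r + [:of_real (\<beta> - \<alpha>), - of_real (\<alpha> + \<beta> + 2):] * r"
  let ?h = "\<lambda>x. poly q (complex_of_real x)"
  let ?w = "\<lambda>x. (1 - x) powr \<alpha> * (1 + x) powr \<beta> :: real"
  have [measurable]: "?h \<in> borel_measurable borel"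
    by (rule borel_measurable_continuous_onI) (intro continuous_intros)
  have "integrable (jacobi_measure \<alpha> \<beta>) ?h"
    by (intro integrable_continuous continuous_intros)
  then have "integrable lborel (\<lambda>x. (indicator {-1..1} x * ?w x) *\<^sub>R ?h x)"
    unfolding jacobi_measure_def by (subst (asm) integrable_density) auto
  then have int: "set_integrable lborel {-1..1} (\<lambda>x. of_real (?w x) * ?h x)"
    by (simp add: set_integrable_def scaleR_conv_of_real mult.assoc)
  have "(\<integral>x. ?h x \<partial>jacobi_measure \<alpha> \<beta>) = (\<integral>x. (indicator {-1..1} x * ?w x) *\<^sub>R ?h x \<partial>lborel)"
    unfolding jacobi_measure_def by (subst integral_density) auto
  also have "\<dots> = (LINT x:{-1..1}|lborel. of_real (?w x) * ?h x)"
    by (simp add: set_lebesgue_integral_def scaleR_conv_of_real mult.assoc)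
  also have "\<dots> = integral {-1..1} (\<lambda>x. of_real (?w x) * ?h x)"
    by (rule set_borel_integral_eq_integral(2)[OF int])
  also have "\<dots> = 0"
    unfolding q_def using has_integral_jacobi[OF \<alpha> \<beta>] by (rule integral_unique)
  finally show ?thesis unfolding q_def .
qed

text \<open>Lagrange's identity: the difference of the two integrands is the expression of
  \<open>integral_jacobi_0\<close> for r = p' q - p q'.\<close>

lemma jacobi_op_symmetric:
  "(\<integral>x. poly (jacobi_op \<alpha> \<beta> p * q) (complex_of_real x) \<partial>jacobi_measure \<alpha> \<beta>) =
   (\<integral>x. poly (p * jacobi_op \<alpha> \<beta> q) (complex_of_real x) \<partial>jacobi_measure \<alpha> \<beta>)"
proof -
  let ?r = "pderiv p * q - p * pderiv q"
  have int: "integrable (jacobi_measure \<alpha> \<beta>) (\<lambda>x. poly h (complex_of_real x))" for h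
    by (intro integrable_continuous continuous_intros)
  have "[:1, 0, -1:] * pderiv ?r + [:of_real (\<beta> - \<alpha>), - of_real (\<alpha> + \<beta> + 2):] * ?r =
    jacobi_op \<alpha> \<beta> p * q - p * jacobi_op \<alpha> \<beta> q"
    unfolding jacobi_op_def pderiv_diff pderiv_mult
    by (simp only: algebra_simps)
  then have "(\<integral>x. poly (jacobi_op \<alpha> \<beta> p * q) (complex_of_real x) -
      poly (p * jacobi_op \<alpha> \<beta> q) (of_real x) \<partial>jacobi_measure \<alpha> \<beta>) = 0"
    using integral_jacobi_0[of ?r] by (simp only: poly_diff)
  then show ?thesis
    by (simp only: Bochner_Integration.integral_diff[OF int int]) simp
qed

text \<open>Symmetry moves the operator onto the power x^k, where it does not raise the
  degree.\<close>

lemma orth_jacobi_op: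
  assumes "orth n p"
  shows "orth n (jacobi_op \<alpha> \<beta> p)"
  unfolding orth_iff_powers
proof (intro allI impI)
  fix k assume "k < n"
  let ?r = "jacobi_op \<alpha> \<beta> (monom 1 k)"
  have "degree_less ?r n"
    using \<open>k < n\<close> by (auto simp: coeff_jacobi_op)
  \<comment> \<open>Conjugated coefficients cancel the conjugation in \<open>ip\<close>, as
    \<open>jacobi_op_symmetric\<close> is bilinear and not Hermitian.\<close>
  then have "degree_less (map_poly cnj ?r) n" by (simp add: coeff_map_poly)
  then have "ip p (map_poly cnj ?r) = 0" by (rule orthD[OF assms])
  then show "(\<integral>x. poly (jacobi_op \<alpha> \<beta> p) (of_real x) * of_real x ^ k \<partial>jacobi_measure \<alpha> \<beta>) = 0"
    using jacobi_op_symmetric[of p "monom 1 k"] by (simp add: ip_def poly_map_cnj poly_monom)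
qed

section \<open>Monic Jacobi polynomials: eigenvalue equation and three-term recurrence\<close>

abbreviation P :: "nat \<Rightarrow> complex poly" where "P \<equiv> monic_op"

lemma orth_degree_less_imp_0: "orth n p \<Longrightarrow> degree_less p n \<Longrightarrow> p = 0"
  using orthD[of n p p] ip_self[of p] nsq_eq_0_iff[of p] by simp

text \<open>Both sides are orthogonal to lower degrees and have the same leading term. Their
  difference is therefore orthogonal to itself and vanishes.\<close>

lemma jacobi_op_P: "jacobi_op \<alpha> \<beta> (P n) = smult (- of_real (real n * (1 + real n + \<alpha> + \<beta>))) (P n)"
proof -
  define r where "r = jacobi_op \<alpha> \<beta> (P n) - smult (- of_real (real n * (1 + real n + \<alpha> + \<beta>))) (P n)"
  have "orth n r"
    using orth_jacobi_op[OF monic_op(3)[of n]] monic_op(3)[of n]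
    unfolding r_def orth_def ip_diff_left ip_smult_left by simp
  moreover have "degree_less r n"
  proof (intro allI impI)
    fix i assume "i \<ge> n"
    then consider "i = n" | "i > n" by linarith
    then show "coeff r i = 0"
      by cases (auto simp: r_def coeff_jacobi_op coeff_monic_op_eq_0)
  qed
  ultimately have "r = 0" by (rule orth_degree_less_imp_0)
  then show ?thesis by (simp only: r_def right_minus_eq)
qed

lemma coeff_P_recurrence:
  "of_real (real n * (1 + real n + \<alpha> + \<beta>) - real k * (1 + real k + \<alpha> + \<beta>)) * coeff (P n) k =
    - (of_real ((real k + 1) * (\<beta> - \<alpha>)) * coeff (P n) (Suc k)
     + of_real ((real k + 1) * (real k + 2)) * coeff (P n) (Suc (Suc k)))"
  using arg_cong[OF jacobi_op_P[of n], of "\<lambda>p. coeff p k"]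
  unfolding coeff_jacobi_op by (simp add: algebra_simps)

text \<open>\<open>s n\<close> and \<open>t n\<close> are the coefficients of x^(n-1) and x^(n-2) in
  \<open>P n\<close>, obtained by solving \<open>coeff_P_recurrence\<close> downwards from the
  leading coefficient 1.\<close>

definition s :: "nat \<Rightarrow> real" where
  "s n = real n * (\<alpha> - \<beta>) / (2 * real n + \<alpha> + \<beta>)"

definition t :: "nat \<Rightarrow> real" where
  "t n = - ((real n - 1) * (real n + (\<beta> - \<alpha>) * s n)) / (2 * (2 * real n - 1 + \<alpha> + \<beta>))"

lemma coeff_P_1: "coeff (P (Suc n)) n = of_real (s (Suc n))"
proof -
  have nz: "2 + 2 * real n + \<alpha> + \<beta> \<noteq> 0" using \<alpha> \<beta> by linarith
  have e: "real (Suc n) * (1 + real (Suc n) + \<alpha> + \<beta>) - real n * (1 + real n + \<alpha> + \<beta>) = 2 + 2 * real n + \<alpha> + \<beta>"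
    by (simp add: algebra_simps)
  have "of_real (2 + 2 * real n + \<alpha> + \<beta>) * coeff (P (Suc n)) n = of_real ((real n + 1) * (\<alpha> - \<beta>))"
    using coeff_P_recurrence[of "Suc n" n, unfolded e]
    by (simp add: monic_op(2) coeff_monic_op_eq_0 algebra_simps)
  then have "coeff (P (Suc n)) n = of_real ((real n + 1) * (\<alpha> - \<beta>)) / of_real (2 + 2 * real n + \<alpha> + \<beta>)"
    using nz by (metis nonzero_mult_div_cancel_left of_real_eq_0_iff)
  then show ?thesis by (simp add: s_def algebra_simps)
qed

lemma coeff_P_2: "coeff (P (Suc (Suc n))) n = of_real (t (Suc (Suc n)))"
proof -
  have nz: "2 * (3 + 2 * real n + \<alpha> + \<beta>) \<noteq> 0" using \<alpha> \<beta> by simp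
  have e: "real (Suc (Suc n)) * (1 + real (Suc (Suc n)) + \<alpha> + \<beta>) - real n * (1 + real n + \<alpha> + \<beta>) =
    2 * (3 + 2 * real n + \<alpha> + \<beta>)"
    by (simp add: algebra_simps)
  have "of_real (2 * (3 + 2 * real n + \<alpha> + \<beta>)) * coeff (P (Suc (Suc n))) n =
    of_real (- (real n + 1) * ((real n + 2) + (\<beta> - \<alpha>) * s (Suc (Suc n))))"
    using coeff_P_recurrence[of "Suc (Suc n)" n, unfolded e]
    by (simp add: coeff_P_1 monic_op(2) coeff_monic_op_eq_0 algebra_simps)
  then have "coeff (P (Suc (Suc n))) n =
      of_real (- (real n + 1) * ((real n + 2) + (\<beta> - \<alpha>) * s (Suc (Suc n)))) / of_real (2 * (3 + 2 * real n + \<alpha> + \<beta>))"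
    using nz by (metis nonzero_mult_div_cancel_left of_real_eq_0_iff)
  then show ?thesis by (simp add: t_def algebra_simps)
qed

text \<open>\<open>a\<close> and \<open>\<gamma>\<close> are the coefficients of the three-term
  recurrence, found by comparing the two coefficients below the leading one.\<close>

definition a :: "nat \<Rightarrow> real" where "a n = s n - s (Suc n)"

definition \<gamma> :: "nat \<Rightarrow> real" where "\<gamma> n = t n - t (Suc n) - a n * s n"

lemma a_tendsto: "a \<longlonglongrightarrow> 0"
  unfolding a_def s_def by real_asymp

lemma \<gamma>_tendsto: "\<gamma> \<longlonglongrightarrow> 1 / 4"
  unfolding \<gamma>_def a_def t_def s_def by (real_asymp; simp add: field_simps)

text \<open>By the choice of \<open>a\<close> and \<open>\<gamma>\<close> the remainder has degree
  below \<open>n\<close>. It is also orthogonal to all such degrees, since multiplication by x can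
  be moved to the other factor; so it is zero.\<close>

lemma three_term_recurrence:
  assumes "n > 0"
  shows "pCons 0 (P (Suc n)) = P (Suc (Suc n)) + smult (of_real (a (Suc n))) (P (Suc n))
     + smult (of_real (\<gamma> (Suc n))) (P n)"
proof -
  define r where "r = pCons 0 (P (Suc n)) - (P (Suc (Suc n)) + smult (of_real (a (Suc n))) (P (Suc n))
     + smult (of_real (\<gamma> (Suc n))) (P n))"
  obtain k where k: "n = Suc k" using assms by (cases n) auto
  have "degree_less r n"
  proof (intro allI impI)
    fix i assume "i \<ge> n"
    then consider "i = n" | "i = Suc n" | "i = Suc (Suc n)" | "i > Suc (Suc n)" by linarith
    then show "coeff r i = 0"
      by cases (auto simp: r_def coeff_P_1 coeff_P_2 monic_op(2) coeff_monic_op_eq_0 coeff_pCons k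
          a_def \<gamma>_def algebra_simps split: nat.splits)
  qed
  moreover have "orth n r"
    unfolding orth_def
  proof (intro allI impI)
    fix q :: "complex poly" assume q: "degree_less q n"
    have "degree_less (pCons 0 q) (Suc n)" using q by (auto simp: coeff_pCons split: nat.splits)
    then have "ip (pCons 0 (P (Suc n))) q = 0"
      unfolding ip_pCons_0 by (rule orthD[OF monic_op(3)])
    moreover have "ip (P j) q = 0" if "j \<ge> n" for j
      using q that by (intro orthD[OF monic_op(3)]) auto
    ultimately show "ip r q = 0"
      by (simp add: r_def ip_diff_left ip_add_left ip_smult_left)
  qed
  ultimately have "r = 0" using orth_degree_less_imp_0 by blast
  then show ?thesis by (simp add: r_def)
qed

text \<open>Evaluates the inner product of x P_(n+1) with P_n in two ways: x P_n has the leading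
  term of P_(n+1), and the recurrence leaves only the \<open>\<gamma>\<close> term. Thus the limit
  of \<open>\<gamma>\<close> controls the norms.\<close>

lemma nsq_P_Suc:
  assumes "n > 0"
  shows "nsq (P (Suc n)) = \<gamma> (Suc n) * nsq (P n)"
proof -
  have "ip (P (Suc n)) (pCons 0 (P n) - P (Suc n)) = 0"
    by (intro orthD[OF monic_op(3)] degree_less_diff_monic) (auto simp: monic_op degree_pCons_eq)
  then have "of_real (nsq (P (Suc n))) = ip (P (Suc n)) (pCons 0 (P n))"
    by (simp add: ip_diff_right ip_self)
  also have "\<dots> = ip (pCons 0 (P (Suc n))) (P n)" by (simp add: ip_pCons_0)
  also have "\<dots> = of_real (\<gamma> (Suc n) * nsq (P n))"
    unfolding three_term_recurrence[OF assms]
    by (simp add: ip_add_left ip_smult_left ip_monic_op)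
  finally show ?thesis by (simp only: of_real_eq_iff)
qed

end

section \<open>The Joukowski map and normal families\<close>

definition joukowski :: "complex \<Rightarrow> complex" where
  "joukowski w = (w + inverse w) / 2"

text \<open>Its level sets are the ellipses with foci -1 and 1, degenerating to [-1,1] at the value
  2. It describes the confocal family continuously on the whole plane, without a branch of the
  square root.\<close>

definition focal_sum :: "complex \<Rightarrow> real" where
  "focal_sum z = cmod (z - 1) + cmod (z + 1)"

lemma continuous_on_focal_sum [continuous_intros]:
  "continuous_on A f \<Longrightarrow> continuous_on A (\<lambda>x. focal_sum (f x))"
  unfolding focal_sum_def by (intro continuous_intros)

text \<open>The distances to the foci are |w - 1|^2 and |w + 1|^2 divided by 2|w|, and the
  parallelogram law adds them. Circles about 0 thus go to confocal ellipses.\<close>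

lemma focal_sum_joukowski:
  assumes "w \<noteq> 0"
  shows "focal_sum (joukowski w) = cmod w + inverse (cmod w)"
proof -
  have 1: "joukowski w - 1 = (w - 1)\<^sup>2 / (2 * w)" and 2: "joukowski w + 1 = (w + 1)\<^sup>2 / (2 * w)"
    using assms by (auto simp: joukowski_def field_simps power2_eq_square)
  have "(cmod (w - 1))\<^sup>2 + (cmod (w + 1))\<^sup>2 = 2 * (cmod w)\<^sup>2 + 2"
    unfolding cmod_power2 by (simp add: power2_eq_square algebra_simps)
  then have "focal_sum (joukowski w) = (2 * (cmod w)\<^sup>2 + 2) / (2 * cmod w)"
    unfolding focal_sum_def 1 2 by (simp add: norm_divide norm_mult norm_power flip: add_divide_distrib)
  also have "\<dots> = cmod w + inverse (cmod w)"
    using assms by (simp add: field_simps power2_eq_square)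
  finally show ?thesis .
qed

lemma joukowski_inverse: "joukowski (inverse w) = joukowski w"
  by (simp add: joukowski_def add.commute)

text \<open>The two solutions w of \<open>joukowski w = z\<close> have product 1, so one of them
  lies in the closed unit disc.\<close>

lemma joukowski_preimage:
  obtains w where "w \<noteq> 0" "cmod w \<le> 1" "joukowski w = z"
proof -
  define v where "v = z + csqrt (z\<^sup>2 - 1)"
  have *: "v * (z - csqrt (z\<^sup>2 - 1)) = 1"
    by (simp add: v_def algebra_simps flip: power2_eq_square)
  then have v: "v \<noteq> 0" "inverse v = z - csqrt (z\<^sup>2 - 1)"
    using inverse_unique[OF *] by auto
  then have "joukowski v = z" by (simp add: joukowski_def v_def)
  show ?thesis
  proof (cases "cmod v \<le> 1")
    case False
    then show ?thesis using that[of "inverse v"] v(1) \<open>joukowski v = z\<close>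
      by (simp add: joukowski_inverse norm_inverse inverse_le_1_iff)
  qed (use that v \<open>joukowski v = z\<close> in blast)
qed

lemma focal_sum_le_dist:
  assumes "x \<in> {-1..1}"
  shows "(focal_sum z - 2) / 2 \<le> cmod (z - of_real x)"
proof -
  have "cmod (z - 1) \<le> cmod (z - of_real x) + cmod (of_real (x - 1))"
    using norm_triangle_ineq[of "z - of_real x" "of_real (x - 1)"] by simp
  moreover have "cmod (z + 1) \<le> cmod (z - of_real x) + cmod (of_real (x + 1))"
    using norm_triangle_ineq[of "z - of_real x" "of_real (x + 1)"] by simp
  ultimately show ?thesis using assms unfolding focal_sum_def norm_of_real by auto
qed

lemma add_inverse_strict_antimono:
  fixes x y :: real
  assumes "0 < x" "x < y" "y \<le> 1"
  shows "y + inverse y < x + inverse x"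
proof -
  have "x * y < 1" using mult_left_le[of y x] assms by linarith
  then have "(y - x) * (x * y) < (y - x) * 1" using assms by (intro mult_strict_left_mono) auto
  then show ?thesis using assms by (simp add: field_simps)
qed

lemma add_inverse_inj:
  fixes x y :: real
  assumes "0 < x" "x \<le> 1" "0 < y" "y \<le> 1" "x + inverse x = y + inverse y"
  shows "x = y"
  using add_inverse_strict_antimono[of x y] add_inverse_strict_antimono[of y x] assms
  by (cases x y rule: linorder_cases) auto

lemma add_inverse_less_iff:
  fixes x y :: real
  assumes "0 < x" "x \<le> 1" "0 < y" "y \<le> 1"
  shows "y + inverse y < x + inverse x \<longleftrightarrow> x < y"
  using add_inverse_strict_antimono[of x y] add_inverse_strict_antimono[of y x] assms
  by (cases x y rule: linorder_cases) auto

text \<open>A preimage on the unit circle satisfies 1/w = cnj w, so z would be the real number Re w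
  in [-1,1].\<close>

lemma focal_sum_gt_2:
  assumes "z \<notin> complex_of_real ` {-1..1}"
  shows "focal_sum z > 2"
proof -
  obtain w where w: "w \<noteq> 0" "cmod w \<le> 1" "joukowski w = z" by (rule joukowski_preimage)
  have "cmod w \<noteq> 1"
  proof
    assume 1: "cmod w = 1"
    then have "w * cnj w = 1" by (metis complex_norm_square of_real_1 one_power2)
    then have "inverse w = cnj w" by (simp add: inverse_unique)
    then have "z = of_real (Re w)"
      using w(3) complex_add_cnj[of w] by (auto simp: joukowski_def)
    moreover have "\<bar>Re w\<bar> \<le> 1" using abs_Re_le_cmod[of w] 1 by simp
    ultimately show False using assms by (auto simp: abs_le_iff)
  qed
  then show ?thesis
    using w focal_sum_joukowski[of w] add_inverse_strict_antimono[of "cmod w" 1] by simp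
qed

text \<open>Equal focal sums mean preimages in the disc of equal modulus. Inverting, z is the image
  of a point \<open>v\<close> with |v| = |phi(\<zeta>)|, and the Joukowski map is cosh composed with
  a logarithm.\<close>

lemma mem_zeta_ellipse:
  assumes "\<zeta> \<notin> complex_of_real ` {-1..1}" "focal_sum z = focal_sum \<zeta>"
  shows "z \<in> zeta_ellipse \<zeta>"
proof -
  define s where "s = sqrt_branch \<zeta>"
  have s: "s\<^sup>2 = \<zeta>\<^sup>2 - 1" "cmod (\<zeta> + s) > 1"
    using theI'[OF sqrt_branch_unique[OF assms(1)]] by (auto simp: s_def sqrt_branch_def)
  have "(\<zeta> + s) * (\<zeta> - s) = 1" using s(1) by (simp add: algebra_simps power2_eq_square)
  then have "inverse (\<zeta> + s) = \<zeta> - s" by (rule inverse_unique)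
  then have \<zeta>: "joukowski (\<zeta> + s) = \<zeta>" by (simp add: joukowski_def)
  define \<rho> where "\<rho> = cmod (phi \<zeta>)"
  have \<rho>: "\<rho> > 1" "\<rho> = cmod (\<zeta> + s)" using s by (simp_all add: \<rho>_def phi_def s_def)
  have f\<zeta>: "focal_sum \<zeta> = inverse \<rho> + inverse (inverse \<rho>)"
    using focal_sum_joukowski[of "\<zeta> + s"] \<rho> by (cases "\<zeta> + s = 0") (simp_all add: \<zeta>)
  obtain w where w: "w \<noteq> 0" "cmod w \<le> 1" "joukowski w = z" by (rule joukowski_preimage)
  have "cmod w + inverse (cmod w) = inverse \<rho> + inverse (inverse \<rho>)"
    using focal_sum_joukowski[OF w(1)] w(3) assms(2) f\<zeta> by simp
  then have "cmod w = inverse \<rho>"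
    using add_inverse_less_iff[of "cmod w" "inverse \<rho>"] add_inverse_less_iff[of "inverse \<rho>" "cmod w"] w \<rho>(1)
    by (force simp: inverse_le_1_iff)
  define v where "v = inverse w"
  have v: "cmod v = \<rho>" "joukowski v = z"
    using w \<open>cmod w = inverse \<rho>\<close> by (simp_all add: v_def norm_inverse joukowski_inverse)
  \<comment> \<open>A logarithm of \<open>v\<close>; \<open>Arg2pi\<close> puts the angle into the
    range [0, 2 pi) required by \<open>zeta_ellipse\<close>.\<close>
  define c where "c = complex_of_real (ln \<rho>) + \<i> * of_real (Arg2pi v)"
  have "exp c = v"
    using Arg2pi_eq[of v] \<rho>(1) v(1) by (simp add: c_def exp_add exp_of_real)
  then have "cosh c = z"
    using v(2) by (simp add: cosh_field_def exp_minus joukowski_def)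
  then show ?thesis
    unfolding zeta_ellipse_def using Arg2pi_ge_0[of v] Arg2pi_lt_2pi[of v]
    by (auto simp: c_def \<rho>_def intro!: exI[of _ "Arg2pi v"])
qed

text \<open>Maximum principle on the region inside the ellipse. For R > 2 this region contains
  [-1,1], where the asymptotics in the punctured disc say nothing.\<close>

lemma poly_norm_le_on_ellipse:
  assumes "\<And>z. focal_sum z = R \<Longrightarrow> cmod (poly q z) \<le> B" "focal_sum v < R"
  shows "cmod (poly q v) \<le> B"
proof (rule maximum_modulus_frontier[of "poly q" "{z. focal_sum z < R}"])
  have op: "open {z. focal_sum z < R}"
    by (intro open_Collect_less continuous_intros)
  have "closed {z. focal_sum z \<le> R}"
    by (intro closed_Collect_le continuous_intros)
  then have "closure {z. focal_sum z < R} \<subseteq> {z. focal_sum z \<le> R}"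
    by (intro closure_minimal) auto
  then have "frontier {z. focal_sum z < R} \<subseteq> {z. focal_sum z = R}"
    using op by (auto simp: frontier_def interior_open)
  then show "cmod (poly q z) \<le> B" if "z \<in> frontier {z. focal_sum z < R}" for z
    using assms(1) that by blast
  show "bounded {z. focal_sum z < R}"
  proof (rule boundedI[of _ "R + 1"])
    fix z assume "z \<in> {z. focal_sum z < R}"
    then have "cmod (z - 1) < R" by (simp add: focal_sum_def) (smt (verit) norm_ge_zero)
    then show "norm z \<le> R + 1" using norm_triangle_ineq[of "z - 1" 1] by simp
  qed
qed (use assms(2) in \<open>auto intro!: holomorphic_intros continuous_intros\<close>)

text \<open>If uniform convergence failed along some indices, Montel would give a convergent
  subsequence of these. Its limit agrees with \<open>f\<close> on \<open>U\<close>, hence on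
  \<open>S\<close> by the identity theorem, a contradiction.\<close>

lemma vitali_convergence:
  assumes "open S" "connected S"
    and hol: "\<And>n::nat. F n holomorphic_on S" "f holomorphic_on S"
    and bdd: "\<And>K. compact K \<Longrightarrow> K \<subseteq> S \<Longrightarrow> \<exists>B. \<forall>n. \<forall>z\<in>K. cmod (F n z) \<le> B"
    and U: "U \<subseteq> S" "\<xi> \<in> S" "\<xi> islimpt U" "\<And>z. z \<in> U \<Longrightarrow> (\<lambda>n. F n z) \<longlonglongrightarrow> f z"
    and K: "compact K" "K \<subseteq> S"
  shows "uniform_limit K F f sequentially"
proof (rule ccontr)
  assume "\<not> uniform_limit K F f sequentially"
  then obtain e where e: "e > 0" "\<not> (\<forall>\<^sub>F n in sequentially. \<forall>z\<in>K. dist (F n z) (f z) < e)"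
    by (auto simp: uniform_limit_iff)
  then have "\<forall>k. \<exists>n\<ge>k. \<exists>z\<in>K. e \<le> dist (F n z) (f z)"
    by (auto simp: eventually_sequentially not_less)
  then obtain n where n: "\<And>k. n k \<ge> k" "\<And>k. \<exists>z\<in>K. e \<le> dist (F (n k) z) (f z)" by metis
  obtain g r where g: "g holomorphic_on S" "strict_mono (r :: nat \<Rightarrow> nat)"
      "\<And>x. x \<in> S \<Longrightarrow> (\<lambda>k. F (n (r k)) x) \<longlonglongrightarrow> g x"
      "\<And>K. compact K \<Longrightarrow> K \<subseteq> S \<Longrightarrow> uniform_limit K ((\<lambda>k. F (n k)) \<circ> r) g sequentially"
  proof (rule Montel[of S "range F" "\<lambda>k. F (n k)"])
    fix K assume "compact K" "K \<subseteq> S"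
    from bdd[OF this] show "\<exists>B. \<forall>h\<in>range F. \<forall>z\<in>K. cmod (h z) \<le> B" by simp
  next
    show "open S" by fact
    show "h holomorphic_on S" if "h \<in> range F" for h using hol that by auto
    show "range (\<lambda>k. F (n k)) \<subseteq> range F" by auto
  qed (rule that)
  \<comment> \<open>The chosen indices \<open>n\<close> need not increase, but
    \<open>n k \<ge> k\<close> suffices for them to tend to infinity.\<close>
  have nr: "filterlim (\<lambda>k. n (r k)) at_top sequentially"
    by (rule filterlim_at_top_mono[OF filterlim_ident], intro always_eventually allI)
       (rule le_trans[OF seq_suble[OF g(2)] n(1)])
  have "g z - f z = 0" if "z \<in> S" for z
  proof (rule analytic_continuation[of "\<lambda>z. g z - f z", OF _ assms(1,2) U(1,2,3) _ that])
    fix z assume "z \<in> U"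
    then have "(\<lambda>k. F (n (r k)) z) \<longlonglongrightarrow> f z"
      by (rule filterlim_compose[OF U(4) nr])
    moreover have "(\<lambda>k. F (n (r k)) z) \<longlonglongrightarrow> g z"
      by (rule g(3)) (use \<open>z \<in> U\<close> U(1) in auto)
    ultimately show "g z - f z = 0" using LIMSEQ_unique by auto
  qed (intro holomorphic_intros g(1) hol(2))
  then have gf: "g z = f z" if "z \<in> K" for z using that K(2) by auto
  have "\<forall>\<^sub>F k in sequentially. \<forall>z\<in>K. dist (F (n (r k)) z) (g z) < e"
    using g(4)[OF K] e(1) by (auto simp: uniform_limit_iff)
  then obtain k where "\<forall>z\<in>K. dist (F (n (r k)) z) (g z) < e"
    by (auto simp: eventually_sequentially)
  moreover obtain z where "z \<in> K" "e \<le> dist (F (n (r k)) z) (f z)" using n(2) by blast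
  ultimately show False using gf[of z] by auto
qed

text \<open>Otherwise values on \<open>K\<close> tend to 0 along some indices. The bound at
  \<open>w\<close> keeps a Montel limit from being identically 0, so by Hurwitz it has no zeros and
  is bounded away from 0 on \<open>K\<close>, a contradiction.\<close>

lemma nonvanishing_family_bounded_below:
  assumes "open S" "connected S"
    and hol: "\<And>n::nat. F n holomorphic_on S"
    and nz: "\<And>n z. z \<in> S \<Longrightarrow> F n z \<noteq> 0"
    and bdd: "\<And>K. compact K \<Longrightarrow> K \<subseteq> S \<Longrightarrow> \<exists>B. \<forall>n. \<forall>z\<in>K. cmod (F n z) \<le> B"
    and w: "w \<in> S" "c > 0" "\<And>n. c \<le> cmod (F n w)"
    and K: "compact K" "K \<subseteq> S"
  shows "\<exists>d>0. \<forall>n. \<forall>z\<in>K. d \<le> cmod (F n z)"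
proof (rule ccontr)
  assume "\<not> ?thesis"
  then have "\<forall>k. \<exists>n. \<exists>z\<in>K. cmod (F n z) < inverse (real (Suc k))"
    by (metis inverse_positive_iff_positive of_nat_0_less_iff zero_less_Suc not_less)
  then obtain n where n: "\<And>k. \<exists>z\<in>K. cmod (F (n k) z) < inverse (real (Suc k))" by metis
  obtain g r where g: "g holomorphic_on S" "strict_mono (r :: nat \<Rightarrow> nat)"
      "\<And>x. x \<in> S \<Longrightarrow> (\<lambda>k. F (n (r k)) x) \<longlonglongrightarrow> g x"
      "\<And>K. compact K \<Longrightarrow> K \<subseteq> S \<Longrightarrow> uniform_limit K ((\<lambda>k. F (n k)) \<circ> r) g sequentially"
  proof (rule Montel[of S "range F" "\<lambda>k. F (n k)"])
    fix K assume "compact K" "K \<subseteq> S"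
    from bdd[OF this] show "\<exists>B. \<forall>h\<in>range F. \<forall>z\<in>K. cmod (h z) \<le> B" by simp
  next
    show "open S" by fact
    show "h holomorphic_on S" if "h \<in> range F" for h using hol that by auto
    show "range (\<lambda>k. F (n k)) \<subseteq> range F" by auto
  qed (rule that)
  have "c \<le> cmod (g w)"
    by (rule Lim_bounded2[OF tendsto_norm[OF g(3)[OF w(1)]]]) (use w(3) in auto)
  then have gw: "g w \<noteq> 0" using w(2) by auto
  have gnz: "g z \<noteq> 0" if "z \<in> S" for z
  \<comment> \<open>Hurwitz's theorem is applied to non-constant limits; a constant limit has the
    nonzero value taken at \<open>w\<close>.\<close>
  proof (cases "g constant_on S")
    case True
    then show ?thesis using gw w(1) that by (auto simp: constant_on_def)
  next
    case False
    show ?thesis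
      by (rule Hurwitz_no_zeros[of S "(\<lambda>k. F (n k)) \<circ> r"]) (use assms(1,2) g(1,4) hol nz False that in \<open>simp_all add: o_def\<close>)
  qed
  have "K \<noteq> {}" using n[of 0] by auto
  moreover have "continuous_on K (\<lambda>z. cmod (g z))"
    using holomorphic_on_imp_continuous_on[OF g(1)] K(2) by (auto intro: continuous_intros continuous_on_subset)
  ultimately obtain z0 where z0: "z0 \<in> K" "\<And>z. z \<in> K \<Longrightarrow> cmod (g z0) \<le> cmod (g z)"
    using continuous_attains_inf[OF K(1)] by blast
  define d where "d = cmod (g z0) / 2"
  have "d > 0" using gnz z0 K by (auto simp: d_def)
  have "\<forall>\<^sub>F k in sequentially. \<forall>z\<in>K. dist (F (n (r k)) z) (g z) < d"
    using g(4)[OF K] \<open>d > 0\<close> by (auto simp: uniform_limit_iff)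
  moreover have "\<forall>\<^sub>F k in sequentially. inverse (real (Suc k)) < d"
    using order_tendstoD(2)[OF LIMSEQ_inverse_real_of_nat \<open>d > 0\<close>] .
  ultimately have "\<forall>\<^sub>F k in sequentially. (\<forall>z\<in>K. dist (F (n (r k)) z) (g z) < d) \<and> inverse (real (Suc k)) < d"
    by (rule eventually_conj)
  then obtain k where k: "\<forall>z\<in>K. dist (F (n (r k)) z) (g z) < d" "inverse (real (Suc k)) < d"
    by (auto simp: eventually_sequentially)
  obtain z where z: "z \<in> K" "cmod (F (n (r k)) z) < inverse (real (Suc (r k)))"
    using n[of "r k"] by blast
  have "inverse (real (Suc (r k))) \<le> inverse (real (Suc k))"
    using seq_suble[OF g(2), of k] by (simp add: field_simps)
  then have "cmod (F (n (r k)) z) < d" using z k by linarith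
  moreover have "cmod (g z) \<ge> 2 * d" using z0(2)[OF z(1)] by (simp add: d_def)
  moreover have "cmod (g z) \<le> cmod (F (n (r k)) z) + dist (F (n (r k)) z) (g z)"
    by (metis dist_commute dist_norm norm_triangle_sub)
  moreover have "dist (F (n (r k)) z) (g z) < d" using k z by blast
  ultimately show False by linarith
qed

section \<open>Ratio asymptotics of the Jacobi polynomials\<close>

abbreviation punctured_disc :: "complex set" where
  "punctured_disc \<equiv> ball 0 1 - {0}"

lemma holomorphic_on_joukowski [holomorphic_intros]:
  "0 \<notin> A \<Longrightarrow> joukowski holomorphic_on A"
  unfolding joukowski_def[abs_def] by (intro holomorphic_intros) auto

lemma continuous_on_joukowski: "0 \<notin> A \<Longrightarrow> continuous_on A joukowski"
  by (intro holomorphic_on_imp_continuous_on holomorphic_intros)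

lemma holomorphic_on_poly_joukowski [holomorphic_intros]:
  assumes "0 \<notin> A"
  shows "(\<lambda>w. poly p (joukowski w)) holomorphic_on A"
  using assms by (intro holomorphic_intros)

lemma tendsto_0_contraction:
  fixes e :: "nat \<Rightarrow> real"
  assumes "\<And>n. e n \<ge> 0" "\<delta> \<longlonglongrightarrow> 0" "\<forall>\<^sub>F n in sequentially. e (Suc n) \<le> e n / 2 + \<delta> n"
  shows "e \<longlonglongrightarrow> 0"
proof (rule LIMSEQ_I)
  fix \<epsilon> :: real assume \<epsilon>: "\<epsilon> > 0"
  have "\<forall>\<^sub>F n in sequentially. \<delta> n < \<epsilon> / 4"
    using order_tendstoD(2)[OF assms(2), of "\<epsilon> / 4"] \<epsilon> by simp
  with assms(3) have "\<forall>\<^sub>F n in sequentially. e (Suc n) \<le> e n / 2 + \<epsilon> / 4"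
    by eventually_elim simp
  then obtain M where M: "\<And>n. n \<ge> M \<Longrightarrow> e (Suc n) \<le> e n / 2 + \<epsilon> / 4"
    by (auto simp: eventually_sequentially)
  \<comment> \<open>The offset \<epsilon>/2 is the fixed point of the map e \<mapsto> e/2 +
    \<epsilon>/4.\<close>
  have bound: "e (M + k) \<le> e M * (1 / 2) ^ k + \<epsilon> / 2" for k
  proof (induction k)
    case 0
    then show ?case using \<epsilon> by simp
  next
    case (Suc k)
    have "e (M + Suc k) \<le> e (M + k) / 2 + \<epsilon> / 4" using M[of "M + k"] by simp
    then show ?case using Suc by simp
  qed
  have "(\<lambda>k. e M * (1 / 2) ^ k) \<longlonglongrightarrow> e M * 0"
    by (intro tendsto_intros) auto
  then have "\<forall>\<^sub>F k in sequentially. e M * (1 / 2) ^ k < \<epsilon> / 2"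
    using \<epsilon> by (intro order_tendstoD(2)) auto
  then obtain k0 where k0: "\<And>k. k \<ge> k0 \<Longrightarrow> e M * (1 / 2) ^ k < \<epsilon> / 2"
    by (auto simp: eventually_sequentially)
  have "norm (e n - 0) < \<epsilon>" if "n \<ge> M + k0" for n
  proof -
    have "n - M \<ge> k0" "M + (n - M) = n" using that by auto
    then show ?thesis using bound[of "n - M"] k0[of "n - M"] assms(1)[of n] by simp
  qed
  then show "\<exists>N. \<forall>n\<ge>N. norm (e n - 0) < \<epsilon>" by blast
qed

text \<open>The reciprocal of (\<open>focal_sum (joukowski w)\<close> - 2)/2, which by
  \<open>focal_sum_le_dist\<close> is a lower bound for the distance of \<open>joukowski w\<close>
  from [-1,1]. It tends to 0 with w, that is, as the image point goes to infinity.\<close>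

definition growth_bound :: "complex \<Rightarrow> real" where
  "growth_bound w = 2 * cmod w / (1 - cmod w)\<^sup>2"

lemma growth_bound_nonneg: "growth_bound w \<ge> 0"
  by (simp add: growth_bound_def)

lemma growth_bound_bounded:
  assumes "compact K" "K \<subseteq> ball 0 1"
  shows "\<exists>B. \<forall>w\<in>K. growth_bound w \<le> B"
proof -
  have "continuous_on K growth_bound"
    unfolding growth_bound_def[abs_def] using assms(2) by (intro continuous_intros) auto
  then have "bounded (growth_bound ` K)"
    using assms(1) by (intro compact_imp_bounded compact_continuous_image)
  then show ?thesis unfolding bounded_iff by (auto simp: abs_le_iff)
qed

section \<open>Growth and ratios of the Jacobi polynomials off the interval\<close>

context jacobi
begin

lemma P_0: "P 0 = 1"
  using monic_op(1,2)[of 0] by (metis degree_0_id one_pCons)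

lemma norm_P_le_P_Suc:
  assumes "w \<in> punctured_disc"
  shows "cmod (poly (P n) (joukowski w)) \<le> growth_bound w * cmod (poly (P (Suc n)) (joukowski w))"
proof -
  define d where "d = (focal_sum (joukowski w) - 2) / 2"
  have w: "w \<noteq> 0" "cmod w < 1" using assms by auto
  have d: "d = (1 - cmod w)\<^sup>2 / (2 * cmod w)"
    using w by (simp add: d_def focal_sum_joukowski field_simps power2_eq_square)
  then have "d > 0" using w by simp
  moreover have "d \<le> cmod (joukowski w - of_real x)" if "x \<in> {-1..1}" for x
    unfolding d_def by (rule focal_sum_le_dist[OF that])
  ultimately have "d * cmod (poly (P n) (joukowski w)) \<le> cmod (poly (P (Suc n)) (joukowski w))"
    by (intro monic_op_growth)
  moreover have g: "growth_bound w = 1 / d" using d by (simp add: growth_bound_def)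
  ultimately show ?thesis using \<open>d > 0\<close> unfolding g by (simp add: field_simps)
qed

lemma norm_P_le_P_add:
  assumes "w \<in> punctured_disc"
  shows "cmod (poly (P n) (joukowski w)) \<le> growth_bound w ^ k * cmod (poly (P (n + k)) (joukowski w))"
proof (induction k)
  case (Suc k)
  have "growth_bound w ^ k * cmod (poly (P (n + k)) (joukowski w)) \<le>
      growth_bound w ^ k * (growth_bound w * cmod (poly (P (Suc (n + k))) (joukowski w)))"
    using norm_P_le_P_Suc[OF assms] growth_bound_nonneg by (intro mult_left_mono) auto
  then show ?case using Suc by (simp add: mult_ac)
qed simp

lemma P_nonzero:
  assumes "w \<in> punctured_disc"
  shows "poly (P n) (joukowski w) \<noteq> 0"
  using norm_P_le_P_add[OF assms, of 0 n] by (auto simp: P_0)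

definition P_ratio :: "nat \<Rightarrow> complex \<Rightarrow> complex" where
  "P_ratio n w = poly (P n) (joukowski w) / poly (P (Suc n)) (joukowski w)"

lemma norm_P_ratio_le: "w \<in> punctured_disc \<Longrightarrow> cmod (P_ratio n w) \<le> growth_bound w"
  using norm_P_le_P_Suc[of w n] P_nonzero[of w "Suc n"]
  by (simp add: P_ratio_def norm_divide divide_le_eq)

lemma P_ratio_recurrence:
  assumes "w \<in> punctured_disc" "n > 0"
  shows "inverse (P_ratio (Suc n) w) = joukowski w - of_real (a (Suc n)) - of_real (\<gamma> (Suc n)) * P_ratio n w"
  using P_nonzero[OF assms(1), of "Suc n"]
    arg_cong[OF three_term_recurrence[OF assms(2)], of "\<lambda>p. poly p (joukowski w)"]
  by (simp add: P_ratio_def field_simps)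

text \<open>
  Near \<open>w = 0\<close> the continued fraction recurrence of the ratios is a contraction towards
  the fixed point \<open>2 w\<close> of the limiting recurrence.
\<close>

lemma P_ratio_tendsto_small:
  assumes "w \<noteq> 0" "cmod w \<le> 1 / 8"
  shows "(\<lambda>n. P_ratio n w) \<longlonglongrightarrow> 2 * w"
proof -
  have w: "w \<in> punctured_disc" using assms by auto
  define \<delta> where "\<delta> n = \<bar>a (Suc n)\<bar> + \<bar>\<gamma> (Suc n) - 1 / 4\<bar>" for n
  have \<delta>: "\<delta> \<longlonglongrightarrow> 0"
  proof -
    have "\<delta> \<longlonglongrightarrow> \<bar>0\<bar> + \<bar>1 / 4 - 1 / 4\<bar>"
      unfolding \<delta>_def[abs_def]
      by (intro tendsto_intros LIMSEQ_Suc[OF a_tendsto] LIMSEQ_Suc[OF \<gamma>_tendsto])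
    then show ?thesis by simp
  qed
  have g: "growth_bound w \<le> 1 / 3"
  proof -
    have "(7 / 8)\<^sup>2 \<le> (1 - cmod w)\<^sup>2" using assms(2) by (intro power_mono) auto
    then have "6 * cmod w \<le> (1 - cmod w)\<^sup>2" using assms(2) by (simp add: power2_eq_square)
    then show ?thesis using w by (simp add: growth_bound_def divide_le_eq)
  qed
  have "\<forall>\<^sub>F n in sequentially. cmod (P_ratio (Suc n) w - 2 * w) \<le> cmod (P_ratio n w - 2 * w) / 2 + \<delta> n"
    using eventually_gt_at_top[of 0] order_tendstoD(2)[OF LIMSEQ_Suc[OF \<gamma>_tendsto], of 1, simplified]
      order_tendstoD(1)[OF LIMSEQ_Suc[OF \<gamma>_tendsto], of 0, simplified]
  proof eventually_elim
    case (elim n)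
    have nz: "P_ratio (Suc n) w \<noteq> 0" using P_nonzero[OF w] by (simp add: P_ratio_def)
    have "P_ratio (Suc n) w - 2 * w = P_ratio (Suc n) w * (2 * w) * (inverse (2 * w) - inverse (P_ratio (Suc n) w))"
      using nz assms(1) by (simp add: field_simps)
    \<comment> \<open>Uses 1/(2w) = \<open>joukowski w\<close> - (1/4)(2w), the limiting recurrence
      at its fixed point 2w.\<close>
    also have "inverse (2 * w) - inverse (P_ratio (Suc n) w) =
       of_real (a (Suc n)) + of_real (\<gamma> (Suc n)) * (P_ratio n w - 2 * w) + of_real (\<gamma> (Suc n) - 1 / 4) * (2 * w)"
      unfolding P_ratio_recurrence[OF w elim(1)] using assms(1) by (simp add: joukowski_def field_simps)
    finally have "cmod (P_ratio (Suc n) w - 2 * w) = cmod (P_ratio (Suc n) w) * (2 * cmod w) *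
       cmod (of_real (a (Suc n)) + of_real (\<gamma> (Suc n)) * (P_ratio n w - 2 * w) + of_real (\<gamma> (Suc n) - 1 / 4) * (2 * w))"
      by (simp add: norm_mult)
    \<comment> \<open>The factor 1/3 bounds the ratio through \<open>g\<close>, and 1/4 bounds 2|w|
      because |w| is at most 1/8.\<close>
    also have "\<dots> \<le> (1 / 3) * (1 / 4) * (\<bar>a (Suc n)\<bar> + \<bar>\<gamma> (Suc n)\<bar> * cmod (P_ratio n w - 2 * w) + \<bar>\<gamma> (Suc n) - 1 / 4\<bar> * (2 * cmod w))"
    proof (intro mult_mono)
      show "cmod (P_ratio (Suc n) w) \<le> 1 / 3"
        using norm_P_ratio_le[OF w] g order_trans by blast
      show "cmod (of_real (a (Suc n)) + of_real (\<gamma> (Suc n)) * (P_ratio n w - 2 * w) + of_real (\<gamma> (Suc n) - 1 / 4) * (2 * w))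
        \<le> \<bar>a (Suc n)\<bar> + \<bar>\<gamma> (Suc n)\<bar> * cmod (P_ratio n w - 2 * w) + \<bar>\<gamma> (Suc n) - 1 / 4\<bar> * (2 * cmod w)"
        by (intro order_trans[OF norm_triangle_ineq] add_mono)
           (simp_all add: norm_mult del: of_real_diff)
    qed (use assms in auto)
    also have "\<dots> \<le> (1 / 3) * (1 / 4) * (\<bar>a (Suc n)\<bar> + 1 * cmod (P_ratio n w - 2 * w) + \<bar>\<gamma> (Suc n) - 1 / 4\<bar> * 1)"
      using elim assms by (intro mult_left_mono add_mono mult_right_mono) auto
    also have "\<dots> \<le> cmod (P_ratio n w - 2 * w) / 2 + \<delta> n" by (simp add: \<delta>_def)
    finally show ?case .
  qed
  then have "(\<lambda>n. cmod (P_ratio n w - 2 * w)) \<longlonglongrightarrow> 0"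
    by (intro tendsto_0_contraction[OF _ \<delta>]) auto
  then show ?thesis by (subst (asm) tendsto_norm_zero_iff) (simp add: LIM_zero_iff)
qed

text \<open>The contraction works only for small |w|. Since \<open>growth_bound\<close> bounds the
  ratios locally uniformly, Vitali's theorem carries the limit to the whole punctured disc.\<close>

lemma P_ratio_uniform_limit:
  assumes "compact K" "K \<subseteq> punctured_disc"
  shows "uniform_limit K P_ratio (\<lambda>w. 2 * w) sequentially"
proof (rule vitali_convergence[of punctured_disc _ _ "ball 0 (1/8) - {0}" "1 / 16"])
  show "open punctured_disc" by (intro open_delete open_ball)
  show "connected punctured_disc" by (intro connected_punctured_ball) simp
  show "P_ratio n holomorphic_on punctured_disc" for n
    unfolding P_ratio_def[abs_def] by (intro holomorphic_intros P_nonzero) auto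
  show "1 / 16 islimpt (ball 0 (1/8) - {0::complex})"
    by (intro interior_limit_point) (auto simp: interior_open open_delete)
  fix L assume "compact L" "L \<subseteq> punctured_disc"
  then show "\<exists>B. \<forall>n. \<forall>w\<in>L. cmod (P_ratio n w) \<le> B"
    using growth_bound_bounded[of L] norm_P_ratio_le by (meson Diff_subset order_trans subsetD)
qed (use assms in \<open>auto intro!: P_ratio_tendsto_small holomorphic_intros\<close>)

lemma P_joukowski_bounds:
  assumes "compact K" "K \<subseteq> punctured_disc"
  obtains c C where "c > 0" "C > 0"
    "\<And>w. w \<in> K \<Longrightarrow> c \<le> cmod (poly (P n) (joukowski w))"
    "\<And>w. w \<in> K \<Longrightarrow> cmod (poly (P n) (joukowski w)) \<le> C"
proof (cases "K = {}")
  case True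
  then show ?thesis using that[of 1 1] by auto
next
  case False
  have cont: "continuous_on K (\<lambda>w. cmod (poly (P n) (joukowski w)))"
    using assms(2) by (intro continuous_intros continuous_on_joukowski) auto
  obtain u where u: "u \<in> K" "\<And>w. w \<in> K \<Longrightarrow> cmod (poly (P n) (joukowski u)) \<le> cmod (poly (P n) (joukowski w))"
    using continuous_attains_inf[OF assms(1) False cont] by blast
  obtain v where v: "v \<in> K" "\<And>w. w \<in> K \<Longrightarrow> cmod (poly (P n) (joukowski w)) \<le> cmod (poly (P n) (joukowski v))"
    using continuous_attains_sup[OF assms(1) False cont] by blast
  show ?thesis
    by (rule that[OF _ _ u(2) v(2)]) (use P_nonzero u(1) v(1) assms(2) in \<open>simp_all add: subset_iff\<close>)
qed

text \<open>For large n the ratios P_n / P_(n+1) are uniformly close to 2w on the annulus. Each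
  further degree thus multiplies the quotient of the value at the outer point (smaller |w'|) by that
  at the inner point by at least \<open>q\<close> > 1, and any \<open>D\<close> is eventually
  exceeded.\<close>

lemma P_geometric_growth:
  assumes "0 < r3" "r3 \<le> r2" "r2 < r1" "r1 < 1"
  shows "\<forall>\<^sub>F n in sequentially. \<forall>w w'. cmod w = r1 \<longrightarrow> r3 \<le> cmod w' \<longrightarrow> cmod w' \<le> r2 \<longrightarrow>
     D * cmod (poly (P n) (joukowski w)) \<le> cmod (poly (P n) (joukowski w'))"
proof -
  define K where "K = {w. r3 \<le> cmod w \<and> cmod w \<le> r1}"
  have K: "compact K" "K \<subseteq> punctured_disc"
  proof -
    have "K = cball 0 r1 - ball 0 r3" by (auto simp: K_def)
    then show "compact K" by (simp add: compact_diff)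
    show "K \<subseteq> punctured_disc" using assms by (auto simp: K_def)
  qed
  \<comment> \<open>A tolerance small enough that the perturbed ratios 2 r2 + \<epsilon> and 2 r1 -
    \<epsilon> stay separated.\<close>
  define \<epsilon> where "\<epsilon> = (r1 - r2) / 2"
  have \<epsilon>: "\<epsilon> > 0" "2 * r2 + \<epsilon> < 2 * r1 - \<epsilon>" using assms by (simp_all add: \<epsilon>_def field_simps)
  define q where "q = (2 * r1 - \<epsilon>) / (2 * r2 + \<epsilon>)"
  have pos: "2 * r2 + \<epsilon> > 0" using assms \<epsilon> by linarith
  have "q > 1" using \<epsilon> pos by (simp add: q_def)
  have "\<forall>\<^sub>F n in sequentially. \<forall>w\<in>K. dist (P_ratio n w) (2 * w) < \<epsilon>"
    using P_ratio_uniform_limit[OF K] \<epsilon>(1) by (auto simp: uniform_limit_iff)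
  then obtain N where N: "\<And>n w. n \<ge> N \<Longrightarrow> w \<in> K \<Longrightarrow> dist (P_ratio n w) (2 * w) < \<epsilon>"
    by (auto simp: eventually_sequentially)
  obtain c C where cC: "c > 0" "C > 0"
    "\<And>w. w \<in> K \<Longrightarrow> c \<le> cmod (poly (P N) (joukowski w))"
    "\<And>w. w \<in> K \<Longrightarrow> cmod (poly (P N) (joukowski w)) \<le> C"
    using P_joukowski_bounds[OF K, of N] by metis
  have main: "q ^ k * c * cmod (poly (P (N + k)) (joukowski w)) \<le> C * cmod (poly (P (N + k)) (joukowski w'))"
    if w: "cmod w = r1" and w': "r3 \<le> cmod w'" "cmod w' \<le> r2" for k w w'
  proof -
    have wK: "w \<in> K" "w' \<in> K" using w w' assms by (auto simp: K_def)
    then have wS: "w \<in> punctured_disc" "w' \<in> punctured_disc" using K by auto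
    show ?thesis
    proof (induction k)
      case 0
      have "c * cmod (poly (P N) (joukowski w)) \<le> cmod (poly (P N) (joukowski w')) * C"
        using cC wK by (intro mult_mono) auto
      then show ?case by (simp add: mult.commute)
    next
      case (Suc k)
      define n where "n = N + k"
      let ?p = "\<lambda>n w. cmod (poly (P n) (joukowski w))"
      have R: "?p n v = cmod (P_ratio n v) * ?p (Suc n) v" if "v \<in> punctured_disc" for v
        using P_nonzero[OF that] by (simp add: P_ratio_def norm_divide)
      have "cmod (2 * w) - cmod (P_ratio n w) \<le> cmod (P_ratio n w - 2 * w)"
        by (metis norm_minus_commute norm_triangle_ineq2)
      then have lo: "2 * r1 - \<epsilon> \<le> cmod (P_ratio n w)"
        using N[of n w] wK w by (simp add: n_def dist_norm norm_mult)
      have "cmod (P_ratio n w') - cmod (2 * w') \<le> cmod (P_ratio n w' - 2 * w')"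
        by (rule norm_triangle_ineq2)
      then have hi: "cmod (P_ratio n w') \<le> 2 * r2 + \<epsilon>"
        using N[of n w'] wK w' by (simp add: n_def dist_norm norm_mult)
      have "q ^ k * c * ((2 * r1 - \<epsilon>) * ?p (Suc n) w) \<le> q ^ k * c * ?p n w"
        using lo \<open>q > 1\<close> cC(1) unfolding R[OF wS(1)] by (intro mult_left_mono mult_right_mono) auto
      also have "\<dots> \<le> C * ?p n w'" using Suc by (simp add: n_def)
      also have "\<dots> \<le> C * ((2 * r2 + \<epsilon>) * ?p (Suc n) w')"
        using hi cC(2) unfolding R[OF wS(2)] by (intro mult_left_mono mult_right_mono) auto
      finally have "q ^ k * c * ((2 * r1 - \<epsilon>) * ?p (Suc n) w) / (2 * r2 + \<epsilon>) \<le> C * ?p (Suc n) w'"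
        using pos by (simp add: divide_le_eq mult_ac)
      then show ?case by (simp add: n_def q_def mult_ac)
    qed
  qed
  obtain k0 where "C / c * D < q ^ k0" using real_arch_pow[OF \<open>q > 1\<close>] by blast
  have k: "C * D \<le> q ^ k * c" if "k \<ge> k0" for k
  proof -
    have "q ^ k0 \<le> q ^ k" using that \<open>q > 1\<close> by (intro power_increasing) auto
    then show ?thesis using \<open>C / c * D < q ^ k0\<close> cC(1) by (simp add: field_simps) (smt (verit) mult_left_mono)
  qed
  show ?thesis
    unfolding eventually_sequentially
  proof (intro exI[of _ "N + k0"] allI impI)
    fix n w w' assume *: "N + k0 \<le> n" "cmod w = r1" "r3 \<le> cmod w'" "cmod w' \<le> r2"
    have n: "N + (n - N) = n" "n - N \<ge> k0" using * by auto
    have "C * (D * cmod (poly (P n) (joukowski w))) \<le> q ^ (n - N) * c * cmod (poly (P n) (joukowski w))"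
      using mult_right_mono[OF k[OF n(2)], of "cmod (poly (P n) (joukowski w))"] by (simp add: mult_ac)
    also have "\<dots> \<le> C * cmod (poly (P n) (joukowski w'))"
      using main[OF *(2-4), of "n - N"] n by simp
    finally show "D * cmod (poly (P n) (joukowski w)) \<le> cmod (poly (P n) (joukowski w'))"
      using cC(2) by simp
  qed
qed

end

section \<open>Orthogonal polynomials in terms of Jacobi polynomials\<close>

lemma poly_map_of_real: "poly (map_poly complex_of_real p) (of_real x) = of_real (poly p x)"
  by (induction p) (auto simp: map_poly_pCons)

lemma integral_density_inverse:
  fixes f :: "'a \<Rightarrow> 'b::{banach, second_countable_topology}"
  assumes [measurable]: "f \<in> borel_measurable M" "r \<in> borel_measurable M" and "AE x in M. r x > 0"
  shows "(\<integral>x. f x \<partial>M) = (\<integral>x. r x *\<^sub>R f x \<partial>density M (\<lambda>x. ennreal (1 / r x)))"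
proof -
  have "(\<integral>x. r x *\<^sub>R f x \<partial>density M (\<lambda>x. ennreal (1 / r x))) = (\<integral>x. (1 / r x) *\<^sub>R r x *\<^sub>R f x \<partial>M)"
    by (rule integral_density) (use assms(3) in \<open>auto elim!: eventually_mono\<close>)
  also have "\<dots> = (\<integral>x. f x \<partial>M)"
    by (rule integral_cong_AE) (use assms(3) in \<open>auto elim!: eventually_mono\<close>)
  finally show ?thesis by simp
qed

locale jacobi_quotient =
  fixes \<alpha> \<beta> :: real and \<rho> :: "real poly"
  assumes \<alpha>_gt: "\<alpha> > -1" and \<beta>_gt: "\<beta> > -1"
    and \<rho>_nonzero: "\<rho> \<noteq> 0" and \<rho>_nonneg: "\<And>x. x \<in> {-1..1} \<Longrightarrow> poly \<rho> x \<ge> 0"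
    and finite_quotient: "finite_measure (density (jacobi_measure \<alpha> \<beta>) (\<lambda>x. ennreal (1 / poly \<rho> x)))"
begin

abbreviation \<nu> :: "real measure" where "\<nu> \<equiv> jacobi_measure \<alpha> \<beta>"

abbreviation \<mu> :: "real measure" where "\<mu> \<equiv> density \<nu> (\<lambda>x. ennreal (1 / poly \<rho> x))"

lemma AE_\<rho>_pos: "AE x in \<nu>. poly \<rho> x > 0"
proof -
  have "AE x in \<nu>. x \<notin> {x. poly \<rho> x = 0}"
    by (rule AE_jacobi_finite) (rule poly_roots_finite[OF \<rho>_nonzero])
  with AE_jacobi_interval show ?thesis
    by eventually_elim (use \<rho>_nonneg in force)
qed

lemma measurable_\<rho> [measurable]: "poly \<rho> \<in> borel_measurable \<nu>"
  by (subst measurable_cong_sets[OF sets_jacobi refl], rule borel_measurable_continuous_onI)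
     (intro continuous_intros)

lemma \<rho>_bounded:
  obtains C where "C > 0" "\<forall>x\<in>{-1..1}. poly \<rho> x \<le> C"
proof -
  have "compact (poly \<rho> ` {-1..1})" by (intro compact_continuous_image continuous_intros) auto
  then obtain C where "\<forall>x\<in>{-1..1}. norm (poly \<rho> x) \<le> C"
    using compact_imp_bounded[of "poly \<rho> ` {-1..1}"] by (auto simp: bounded_iff)
  then show ?thesis by (intro that[of "max C 1"]) (auto simp: abs_le_iff le_max_iff_disj)
qed

text \<open>As \<rho> is at most \<open>C\<close> on the interval, the Jacobi measure is dominated
  by \<open>C\<close> times the finite measure \<mu>.\<close>

lemma finite_\<nu>: "finite_measure \<nu>"
proof -
  obtain C where C: "C > 0" "\<forall>x\<in>{-1..1}. poly \<rho> x \<le> C" by (rule \<rho>_bounded)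
  have "emeasure \<nu> (space \<nu>) = (\<integral>\<^sup>+x. 1 \<partial>\<nu>)" by simp
  also have "\<dots> \<le> (\<integral>\<^sup>+x. ennreal C * ennreal (1 / poly \<rho> x) \<partial>\<nu>)"
  proof (rule nn_integral_mono_AE)
    show "AE x in \<nu>. 1 \<le> ennreal C * ennreal (1 / poly \<rho> x)"
      using AE_\<rho>_pos AE_jacobi_interval
      by eventually_elim (use C in \<open>auto simp: ennreal_mult'[symmetric] field_simps\<close>)
  qed
  also have "\<dots> = ennreal C * (\<integral>\<^sup>+x. ennreal (1 / poly \<rho> x) \<partial>\<nu>)"
    by (rule nn_integral_cmult) measurable
  also have "(\<integral>\<^sup>+x. ennreal (1 / poly \<rho> x) \<partial>\<nu>) = emeasure \<mu> (space \<mu>)"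
    by (subst emeasure_density) auto
  also have "ennreal C * emeasure \<mu> (space \<mu>) < \<infinity>"
    using finite_measure.emeasure_finite[OF finite_quotient, of "space \<mu>"]
    by (simp add: ennreal_mult_less_top less_top)
  finally show ?thesis by (intro finite_measureI) auto
qed

sublocale jacobi \<alpha> \<beta>
  by (rule jacobi.intro[OF \<alpha>_gt \<beta>_gt finite_\<nu>])

lemma interval_measure_\<mu>: "interval_measure \<mu>"
proof (rule interval_measure.intro[OF finite_quotient], unfold_locales)
  show "sets \<mu> = sets borel" by simp
  show "AE x in \<mu>. x \<in> {-1..1}"
  proof (subst AE_density)
    show "AE x in \<nu>. 0 < ennreal (1 / poly \<rho> x) \<longrightarrow> x \<in> {-1..1}"
      using AE_jacobi_interval by eventually_elim simp
  qed measurable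
  fix A :: "real set" assume A: "finite A"
  show "\<not> (AE x in \<mu>. x \<in> A)"
  proof
    assume "AE x in \<mu>. x \<in> A"
    then have "AE x in \<nu>. 0 < ennreal (1 / poly \<rho> x) \<longrightarrow> x \<in> A"
      by (subst (asm) AE_density) auto
    with AE_\<rho>_pos have "AE x in \<nu>. x \<in> A" by eventually_elim auto
    then show False using not_AE_jacobi_finite[OF A] by blast
  qed
qed

sublocale mu: interval_measure \<mu>
  by (rule interval_measure_\<mu>)

lemma integral_\<nu>_eq:
  fixes f :: "real \<Rightarrow> 'b::{banach, second_countable_topology}"
  assumes "continuous_on UNIV f"
  shows "(\<integral>x. f x \<partial>\<nu>) = (\<integral>x. poly \<rho> x *\<^sub>R f x \<partial>\<mu>)"
proof (rule integral_density_inverse[OF _ measurable_\<rho> AE_\<rho>_pos])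
  show "f \<in> borel_measurable \<nu>"
    by (subst measurable_cong_sets[OF sets_jacobi refl]) (rule borel_measurable_continuous_onI[OF assms])
qed

section \<open>Comparison of the inner products of the Jacobi measure and of \<mu>\<close>

definition \<rho>c :: "complex poly" where "\<rho>c = map_poly complex_of_real \<rho>"

lemma ip_eq_mu_ip: "ip p q = mu.ip p (\<rho>c * q)"
proof -
  have "ip p q = (\<integral>x. poly \<rho> x *\<^sub>R (poly p (of_real x) * cnj (poly q (of_real x))) \<partial>\<mu>)"
    unfolding ip_def by (intro integral_\<nu>_eq continuous_intros)
  also have "\<dots> = mu.ip p (\<rho>c * q)"
    unfolding mu.ip_def \<rho>c_def poly_mult poly_map_of_real scaleR_conv_of_real
    by (intro Bochner_Integration.integral_cong refl) (simp only: complex_cnj_mult complex_cnj_complex_of_real mult_ac)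
  finally show ?thesis .
qed

lemma nsq_eq: "nsq p = (\<integral>x. poly \<rho> x * (cmod (poly p (of_real x)))\<^sup>2 \<partial>\<mu>)"
proof -
  have "continuous_on UNIV (\<lambda>x. (cmod (poly p (complex_of_real x)))\<^sup>2)"
    by (intro continuous_intros)
  from integral_\<nu>_eq[OF this] show ?thesis unfolding nsq_def real_scaleR_def .
qed

lemma nsq_le_mu_nsq:
  obtains C where "C > 0" "\<forall>p. nsq p \<le> C * mu.nsq p"
proof -
  obtain C where C: "C > 0" "\<forall>x\<in>{-1..1}. poly \<rho> x \<le> C" by (rule \<rho>_bounded)
  have "nsq p \<le> C * mu.nsq p" for p
  proof -
    have "nsq p \<le> (\<integral>x. C * (cmod (poly p (of_real x)))\<^sup>2 \<partial>\<mu>)"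
      unfolding nsq_eq
    proof (rule integral_mono_AE)
      show "AE x in \<mu>. poly \<rho> x * (cmod (poly p (of_real x)))\<^sup>2 \<le> C * (cmod (poly p (of_real x)))\<^sup>2"
        using mu.AE_interval by eventually_elim (intro mult_right_mono C(2)[rule_format], auto)
    qed (intro mu.integrable_continuous continuous_intros)+
    then show ?thesis by (simp add: mu.nsq_def)
  qed
  then show ?thesis using C(1) that by auto
qed

definition m :: nat where "m = degree \<rho>"

text \<open>The monic multiple of \<rho>, so that \<open>\<rho>m * P (n - m)\<close> can compete in
  the extremal problem for degree n.\<close>

definition \<rho>m :: "complex poly" where "\<rho>m = smult (inverse (of_real (lead_coeff \<rho>))) \<rho>c"

lemma degree_\<rho>c: "degree \<rho>c = m"
  by (simp add: \<rho>c_def m_def degree_map_poly)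

lemma monic_\<rho>m: "monic_of_degree m \<rho>m"
  using \<rho>_nonzero degree_\<rho>c by (simp add: \<rho>m_def) (simp add: \<rho>c_def coeff_map_poly m_def)

text \<open>Of the two factors \<rho> in |\<rho>m|^2, one turns \<mu> back into the Jacobi measure
  and the other is bounded on the interval.\<close>

lemma mu_nsq_\<rho>m_mult:
  obtains K where "K > 0" "\<forall>p. mu.nsq (\<rho>m * p) \<le> K * nsq p"
proof -
  obtain C where C: "C > 0" "\<forall>x\<in>{-1..1}. poly \<rho> x \<le> C" by (rule \<rho>_bounded)
  define K where "K = C / (lead_coeff \<rho>)\<^sup>2"
  have K: "K > 0" using C \<rho>_nonzero by (simp add: K_def)
  have "mu.nsq (\<rho>m * p) \<le> K * nsq p" for p
  proof -
    have "mu.nsq (\<rho>m * p) \<le> (\<integral>x. K * (poly \<rho> x * (cmod (poly p (of_real x)))\<^sup>2) \<partial>\<mu>)"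
      unfolding mu.nsq_def
    proof (rule integral_mono_AE)
      show "AE x in \<mu>. (cmod (poly (\<rho>m * p) (of_real x)))\<^sup>2 \<le> K * (poly \<rho> x * (cmod (poly p (of_real x)))\<^sup>2)"
        using mu.AE_interval
      proof eventually_elim
        case (elim x)
        have "(cmod (poly \<rho>m (of_real x)))\<^sup>2 = poly \<rho> x * poly \<rho> x / (lead_coeff \<rho>)\<^sup>2"
          by (simp add: \<rho>m_def \<rho>c_def poly_map_of_real norm_mult norm_inverse power_mult_distrib
              power_inverse divide_inverse mult.commute flip: power2_eq_square)
        also have "\<dots> \<le> poly \<rho> x * C / (lead_coeff \<rho>)\<^sup>2"
          using elim C(2) \<rho>_nonneg by (intro divide_right_mono mult_left_mono) auto
        finally have "(cmod (poly \<rho>m (of_real x)))\<^sup>2 \<le> K * poly \<rho> x"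
          by (simp add: K_def mult.commute)
        then have "(cmod (poly \<rho>m (of_real x)))\<^sup>2 * (cmod (poly p (of_real x)))\<^sup>2 \<le>
            K * poly \<rho> x * (cmod (poly p (of_real x)))\<^sup>2"
          by (rule mult_right_mono) simp
        then show ?case by (simp add: norm_mult power_mult_distrib mult.assoc)
      qed
    qed (intro mu.integrable_continuous continuous_intros)+
    then show ?thesis unfolding nsq_eq by simp
  qed
  then show ?thesis using K that by auto
qed

text \<open>Since \<open>\<gamma>\<close> tends to 1/4 > 1/8, the norm eventually loses at most a
  factor 8 per degree.\<close>

lemma nsq_P_eventually_le:
  "\<forall>\<^sub>F n in sequentially. \<forall>j\<le>m. nsq (P (n - m)) \<le> 8 ^ m * nsq (P (n - j))"
proof -
  have "\<forall>\<^sub>F n in sequentially. \<gamma> n > 1 / 8"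
    using order_tendstoD(1)[OF \<gamma>_tendsto, of "1 / 8"] by simp
  then obtain N where N: "\<And>n. n \<ge> N \<Longrightarrow> \<gamma> n > 1 / 8" by (auto simp: eventually_sequentially)
  have step: "nsq (P n) \<le> 8 * nsq (P (Suc n))" if "n \<ge> Suc N" for n
  proof -
    have "(1 / 8) * nsq (P n) \<le> \<gamma> (Suc n) * nsq (P n)"
      using N[of "Suc n"] that nsq_nonneg by (intro mult_right_mono) auto
    then show ?thesis using nsq_P_Suc[of n] that by simp
  qed
  have iter: "nsq (P n) \<le> 8 ^ k * nsq (P (n + k))" if "n \<ge> Suc N" for n k
  proof (induction k)
    case (Suc k)
    note Suc
    also have "8 ^ k * nsq (P (n + k)) \<le> 8 ^ k * (8 * nsq (P (Suc (n + k))))"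
      using step[of "n + k"] that by (intro mult_left_mono) auto
    finally show ?case by (simp add: mult.assoc)
  qed simp
  show ?thesis
    unfolding eventually_sequentially
  proof (intro exI[of _ "Suc N + m"] allI impI)
    fix n j assume n: "Suc N + m \<le> n" and j: "j \<le> m"
    have "nsq (P (n - m)) \<le> 8 ^ (m - j) * nsq (P (n - m + (m - j)))"
      using n by (intro iter) auto
    also have "\<dots> \<le> 8 ^ m * nsq (P (n - m + (m - j)))"
      by (intro mult_right_mono power_increasing nsq_nonneg) auto
    also have "n - m + (m - j) = n - j" using n j by auto
    finally show "nsq (P (n - m)) \<le> 8 ^ m * nsq (P (n - j))" .
  qed
qed

text \<open>For k < n - m the product \<rho> P_k has degree below n, so the Fourier coefficient of
  \<open>L\<close> at P_k vanishes. The bound on \<open>b j\<close> keeps a single term of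
  Parseval's identity.\<close>

lemma orthogonal_expansion:
  assumes L: "monic_of_degree n L" "mu.orth n L" and "m \<le> n"
  obtains b where "L = (\<Sum>j\<le>m. smult (b j) (P (n - j)))" "b 0 = 1"
    "\<forall>j\<le>m. (cmod (b j))\<^sup>2 * nsq (P (n - j)) \<le> nsq L"
proof -
  have "\<exists>c. L = (\<Sum>k<Suc n. smult (c k) (P k))"
    using L(1) by (intro monic_expansion) (auto simp: monic_op coeff_eq_0)
  then obtain c where c: "L = (\<Sum>k<Suc n. smult (c k) (P k))" by blast
  have ipL: "ip L (P k) = c k * of_real (nsq (P k))" if "k \<le> n" for k
  proof -
    have "ip L (P k) = (\<Sum>j<Suc n. if j = k then c k * of_real (nsq (P k)) else 0)"
      unfolding c ip_sum_left by (intro sum.cong) (auto simp: ip_smult_left ip_monic_op)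
    then show ?thesis using that by simp
  qed
  have c0: "c k = 0" if "k + m < n" for k
  proof -
    have "degree (\<rho>c * P k) < n"
      using degree_mult_le[of \<rho>c "P k"] that by (simp add: degree_\<rho>c monic_op)
    then have "degree_less (\<rho>c * P k) n" by (simp add: coeff_eq_0)
    then have "ip L (P k) = 0"
      unfolding ip_eq_mu_ip by (rule mu.orthD[OF L(2)])
    then show ?thesis using ipL[of k] that by (simp add: nsq_eq_0_iff)
  qed
  have cn: "c n = 1"
  proof -
    have "coeff L n = (\<Sum>k<Suc n. c k * coeff (P k) n)" by (subst c) (simp add: coeff_sum)
    also have "\<dots> = (\<Sum>k<Suc n. if k = n then c n else 0)"
      by (intro sum.cong) (auto simp: monic_op coeff_monic_op_eq_0)
    finally show ?thesis using L(1) by simp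
  qed
  have "L = (\<Sum>k\<in>{n - m..n}. smult (c k) (P k))"
    by (subst c, rule sum.mono_neutral_right) (auto simp: c0)
  also have "\<dots> = (\<Sum>j\<le>m. smult (c (n - j)) (P (n - j)))"
    by (rule sum.reindex_bij_witness[of _ "\<lambda>j. n - j" "\<lambda>k. n - k"]) (use \<open>m \<le> n\<close> in auto)
  finally have L_eq: "L = (\<Sum>j\<le>m. smult (c (n - j)) (P (n - j)))" .
  have "of_real (nsq L) = (\<Sum>k<Suc n. c k * ip (P k) L)"
    unfolding ip_self[symmetric] by (subst (1) c) (simp only: ip_sum_left ip_smult_left)
  also have "\<dots> = of_real (\<Sum>k<Suc n. (cmod (c k))\<^sup>2 * nsq (P k))"
    unfolding of_real_sum
    by (intro sum.cong refl, subst ip_commute) (simp add: ipL flip: complex_norm_square)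
  finally have parseval: "nsq L = (\<Sum>k<Suc n. (cmod (c k))\<^sup>2 * nsq (P k))"
    by (simp only: of_real_eq_iff)
  have "(cmod (c (n - j)))\<^sup>2 * nsq (P (n - j)) \<le> nsq L" for j
    unfolding parseval by (rule member_le_sum) (auto simp: nsq_nonneg)
  then show ?thesis using that[of "\<lambda>j. c (n - j)"] L_eq cn by simp
qed

text \<open>Combines Parseval with extremality: \<open>nsq L\<close> is at most C
  \<open>mu.nsq L\<close>, hence at most C times the \<mu>-norm of the competitor
  \<open>\<rho>m * P (n - m)\<close>. This is at most C K \<open>nsq (P (n - m))\<close>, and
  passing to \<open>P (n - j)\<close> costs at most 8^m.\<close>

lemma orthogonal_expansion_bounded:
  obtains B where "B > 0"
    "\<forall>\<^sub>F n in sequentially. \<forall>L. monic_of_degree n L \<longrightarrow> mu.orth n L \<longrightarrow>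
      (\<exists>b. L = (\<Sum>j\<le>m. smult (b j) (P (n - j))) \<and> b 0 = 1 \<and> (\<forall>j\<le>m. cmod (b j) \<le> B))"
proof -
  obtain C where C: "C > 0" "\<forall>p. nsq p \<le> C * mu.nsq p" by (rule nsq_le_mu_nsq)
  obtain K where K: "K > 0" "\<forall>p. mu.nsq (\<rho>m * p) \<le> K * nsq p" by (rule mu_nsq_\<rho>m_mult)
  define B where "B = sqrt (C * K * 8 ^ m)"
  have "\<forall>\<^sub>F n in sequentially. \<forall>L. monic_of_degree n L \<longrightarrow> mu.orth n L \<longrightarrow>
      (\<exists>b. L = (\<Sum>j\<le>m. smult (b j) (P (n - j))) \<and> b 0 = 1 \<and> (\<forall>j\<le>m. cmod (b j) \<le> B))"
    using nsq_P_eventually_le eventually_ge_at_top[of m]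
  proof eventually_elim
    case (elim n)
    show ?case
    proof (intro allI impI)
      fix L assume L: "monic_of_degree n L" "mu.orth n L"
      obtain b where b: "L = (\<Sum>j\<le>m. smult (b j) (P (n - j)))" "b 0 = 1"
        "\<forall>j\<le>m. (cmod (b j))\<^sup>2 * nsq (P (n - j)) \<le> nsq L"
        by (rule orthogonal_expansion[OF L elim(2)])
      have "monic_of_degree n (\<rho>m * P (n - m))"
      proof -
        have "\<rho>m \<noteq> 0" using monic_\<rho>m by auto
        then have "degree (\<rho>m * P (n - m)) = n"
          using elim(2) monic_\<rho>m by (simp add: degree_mult_eq monic_op)
        moreover have "lead_coeff (\<rho>m * P (n - m)) = 1"
          unfolding lead_coeff_mult using monic_\<rho>m by (simp add: monic_op)
        ultimately show ?thesis by simp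
      qed
      then have "mu.nsq L \<le> mu.nsq (\<rho>m * P (n - m))" by (rule mu.nsq_monic_le[OF L(2,1)])
      also have "\<dots> \<le> K * nsq (P (n - m))" using K(2) by simp
      finally have "C * mu.nsq L \<le> C * (K * nsq (P (n - m)))" using C(1) by simp
      then have nL: "nsq L \<le> C * K * nsq (P (n - m))" using C(2)[rule_format, of L] by simp
      have "cmod (b j) \<le> B" if "j \<le> m" for j
      proof -
        have "(cmod (b j))\<^sup>2 * nsq (P (n - j)) \<le> C * K * nsq (P (n - m))"
          using b(3)[rule_format, OF that] nL by linarith
        also have "\<dots> \<le> C * K * (8 ^ m * nsq (P (n - j)))"
          using elim(1) that C(1) K(1) by (intro mult_left_mono) auto
        finally have "(cmod (b j))\<^sup>2 \<le> C * K * 8 ^ m"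
          using nsq_pos[of "P (n - j)"] by (simp flip: mult.assoc)
        then show ?thesis unfolding B_def by (rule real_le_rsqrt)
      qed
      then show "\<exists>b. L = (\<Sum>j\<le>m. smult (b j) (P (n - j))) \<and> b 0 = 1 \<and> (\<forall>j\<le>m. cmod (b j) \<le> B)"
        using b by blast
    qed
  qed
  moreover have "B > 0" using C K by (simp add: B_def)
  ultimately show ?thesis using that by blast
qed

end

lemma joukowski_notin_interval:
  assumes "w \<in> punctured_disc"
  shows "joukowski w \<notin> complex_of_real ` {-1..1}"
proof
  assume "joukowski w \<in> complex_of_real ` {-1..1}"
  then obtain x where x: "x \<in> {-1..1}" "joukowski w = of_real x" by blast
  then have "focal_sum (joukowski w) \<le> 2" using focal_sum_le_dist[of x "joukowski w"] by simp
  moreover have "focal_sum (joukowski w) > 2"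
    using assms focal_sum_joukowski[of w] add_inverse_strict_antimono[of "cmod w" 1] by simp
  ultimately show False by simp
qed

text \<open>Supplies a point near infinity in the z-plane, where the leading Jacobi polynomial
  dominates a combination with bounded coefficients.\<close>

lemma growth_bound_small:
  assumes "B > 0"
  obtains w where "w \<in> punctured_disc" "growth_bound w \<le> 1" "B * growth_bound w \<le> 1 / 2"
proof -
  \<comment> \<open>For r at most 1/2 the growth bound is at most 8 r; the choice of
    \<open>r\<close> makes B times this at most 1/2.\<close>
  define r where "r = 1 / (16 * (B + 1))"
  have r: "0 < r" "r \<le> 1 / 2" "8 * r \<le> 1" "B * (8 * r) \<le> 1 / 2" using assms by (auto simp: r_def field_simps)
  have "(1 / 2)\<^sup>2 \<le> (1 - r)\<^sup>2" using r by (intro power_mono) auto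
  then have "2 * r / (1 - r)\<^sup>2 \<le> 2 * r / (1 / 2)\<^sup>2"
    using r by (intro divide_left_mono) auto
  then have g: "growth_bound (of_real r) \<le> 8 * r"
    using r by (simp add: growth_bound_def power2_eq_square)
  then have "B * growth_bound (of_real r) \<le> B * (8 * r)" using assms by (intro mult_left_mono) auto
  then show ?thesis using that[of "of_real r"] g r by simp
qed

section \<open>Inverting the operator and bounding the orthogonal polynomials from below\<close>

context jacobi_quotient
begin

text \<open>Minus the eigenvalue \<open>\<lambda>\<^sub>n\<close>, hence positive for n > 0.\<close>

definition lam :: "nat \<Rightarrow> real" where "lam n = real n * (1 + real n + \<alpha> + \<beta>)"

lemma lam_pos: "n > 0 \<Longrightarrow> lam n > 0"
  unfolding lam_def by (rule jacobi_eigenvalue_pos[OF \<alpha>_gt \<beta>_gt])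

lemma lam_quotient_tendsto: "(\<lambda>n. lam n / lam (n - j)) \<longlonglongrightarrow> 1"
proof -
  \<comment> \<open>Shifting by \<open>j\<close> removes the truncated subtraction before the limit
    is computed.\<close>
  have "(\<lambda>n. lam (n + j) / lam (n + j - j)) \<longlonglongrightarrow> 1"
    unfolding lam_def add_diff_cancel_right' by real_asymp
  then show ?thesis by (rule LIMSEQ_offset)
qed

text \<open>The operator multiplies the leading coefficient by -\<open>lam n\<close>, so this
  normalisation turns the image of \<open>q\<close> into the monic orthogonal polynomial for
  \<mu>.\<close>

lemma monic_orthogonal_image:
  assumes "is_monic_orthogonal_wrt_op (jacobi_op \<alpha> \<beta>) \<mu> n q" "n > 0"
  defines "L \<equiv> smult (- inverse (of_real (lam n))) (jacobi_op \<alpha> \<beta> q)"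
  shows "monic_of_degree n L" "mu.orth n L" "jacobi_op \<alpha> \<beta> q = smult (- of_real (lam n)) L"
proof -
  have q: "degree q = n" "coeff q n = 1"
    "\<And>k. k < n \<Longrightarrow> (\<integral>x. poly (jacobi_op \<alpha> \<beta> q) (of_real x) * of_real x ^ k \<partial>\<mu>) = 0"
    using assms(1) by (auto simp: is_monic_orthogonal_wrt_op_def)
  have nz: "complex_of_real (lam n) \<noteq> 0" using lam_pos[OF assms(2)] by simp
  have c: "coeff L n = 1"
    using nz q by (simp add: L_def coeff_jacobi_op coeff_eq_0 flip: lam_def of_real_mult)
  moreover have "coeff L i = 0" if "i > n" for i
    using that q by (simp add: L_def coeff_jacobi_op coeff_eq_0)
  ultimately show "monic_of_degree n L"
    by (intro conjI antisym degree_le le_degree) auto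
  have "mu.orth n (jacobi_op \<alpha> \<beta> q)"
    unfolding mu.orth_iff_powers using q(3) by blast
  then show "mu.orth n L" by (simp add: L_def mu.orth_def mu.ip_smult_left del: smult_minus_left)
  show "jacobi_op \<alpha> \<beta> q = smult (- of_real (lam n)) L"
    using nz by (simp add: L_def)
qed

text \<open>
  Undoing the differential operator only multiplies the coefficients of the Jacobi expansion by
  \<open>\<lambda>\<^sub>n / \<lambda>\<^sub>n\<^sub>-\<^sub>j \<rightarrow> 1\<close>.
\<close>

definition primitive :: "nat \<Rightarrow> (nat \<Rightarrow> complex) \<Rightarrow> complex poly" where
  "primitive n b = (\<Sum>j\<le>m. smult (of_real (lam n / lam (n - j)) * b j) (P (n - j)))"

text \<open>\<open>q\<close> and \<open>primitive n b\<close> have the same image, so they differ by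
  a constant, which cancels in differences of values. The condition n > m keeps every
  \<open>lam (n - j)\<close> nonzero.\<close>

lemma poly_diff_primitive:
  assumes "jacobi_op \<alpha> \<beta> q = smult (- of_real (lam n)) (\<Sum>j\<le>m. smult (b j) (P (n - j)))" "n > m"
  shows "poly q u - poly q v = poly (primitive n b) u - poly (primitive n b) v"
proof -
  have "jacobi_op \<alpha> \<beta> (primitive n b) = (\<Sum>j\<le>m. smult (- of_real (lam n) * b j) (P (n - j)))"
    unfolding primitive_def jacobi_op_sum
  proof (intro sum.cong refl)
    fix j assume "j \<in> {..m}"
    then have "lam (n - j) \<noteq> 0" using lam_pos[of "n - j"] assms(2) by auto
    then show "jacobi_op \<alpha> \<beta> (smult (of_real (lam n / lam (n - j)) * b j) (P (n - j))) =
        smult (- of_real (lam n) * b j) (P (n - j))"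
      unfolding jacobi_op_smult jacobi_op_P lam_def[symmetric] smult_smult
      by (intro arg_cong[of _ _ "\<lambda>c. smult c _"]) (simp add: field_simps)
  qed
  also have "\<dots> = jacobi_op \<alpha> \<beta> q"
    unfolding assms(1) by (simp add: poly_eq_iff coeff_sum sum_distrib_left mult.assoc sum_negf)
  finally have "jacobi_op \<alpha> \<beta> (q - primitive n b) = 0" by (simp add: jacobi_op_diff)
  then obtain c where "q - primitive n b = [:c:]"
    using jacobi_op_eq_0_imp_const[OF \<alpha>_gt \<beta>_gt] by (metis degree_eq_zeroE)
  then have "poly (q - primitive n b) u = poly (q - primitive n b) v" by simp
  then show ?thesis by (simp add: algebra_simps)
qed

text \<open>Each P_(n-j) is at most \<open>growth_bound w ^ j\<close> times P_n in modulus. The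
  index set is left open because both the full sum and the tail without j = 0 occur.\<close>

lemma norm_P_sum_le:
  assumes "w \<in> punctured_disc" "m \<le> n" "finite J" "J \<subseteq> {..m}" "\<And>j. j \<in> J \<Longrightarrow> cmod (b j) \<le> B"
  shows "cmod (\<Sum>j\<in>J. b j * poly (P (n - j)) (joukowski w)) \<le>
     B * (\<Sum>j\<in>J. growth_bound w ^ j) * cmod (poly (P n) (joukowski w))"
proof -
  have "cmod (\<Sum>j\<in>J. b j * poly (P (n - j)) (joukowski w)) \<le>
      (\<Sum>j\<in>J. B * (growth_bound w ^ j * cmod (poly (P n) (joukowski w))))"
  proof (rule sum_norm_le)
    fix j assume j: "j \<in> J"
    then have "j \<le> m" using assms(4) by auto
    then have "n - j + j = n" using assms(2) by simp
    with norm_P_le_P_add[OF assms(1), of "n - j" j]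
    have "cmod (poly (P (n - j)) (joukowski w)) \<le> growth_bound w ^ j * cmod (poly (P n) (joukowski w))"
      by simp
    moreover have "0 \<le> B" using assms(5)[OF j] norm_ge_zero order_trans by blast
    ultimately show "cmod (b j * poly (P (n - j)) (joukowski w)) \<le>
        B * (growth_bound w ^ j * cmod (poly (P n) (joukowski w)))"
      unfolding norm_mult using assms(5)[OF j] by (intro mult_mono) auto
  qed
  then show ?thesis by (simp add: sum_distrib_left sum_distrib_right mult.assoc)
qed

text \<open>Applies \<open>nonvanishing_family_bounded_below\<close> to L_n / P_n: zero-free because
  the zeros of L_n lie in [-1,1], locally bounded by \<open>norm_P_sum_le\<close>, and at least 1/2
  at a point \<open>w0\<close> near 0.\<close>

lemma orthogonal_bounded_below:
  fixes L :: "nat \<Rightarrow> complex poly"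
  assumes L: "\<And>n. n \<ge> N \<Longrightarrow> monic_of_degree n (L n) \<and> mu.orth n (L n)"
    and b: "\<And>n. n \<ge> N \<Longrightarrow> L n = (\<Sum>j\<le>m. smult (b n j) (P (n - j)))"
      "\<And>n. n \<ge> N \<Longrightarrow> b n 0 = 1" "\<And>n j. n \<ge> N \<Longrightarrow> j \<le> m \<Longrightarrow> cmod (b n j) \<le> B"
    and "N > m" and K: "compact K" "K \<subseteq> punctured_disc"
  shows "\<exists>d>0. \<forall>n\<ge>N. \<forall>w\<in>K. d * cmod (poly (P n) (joukowski w)) \<le> cmod (poly (L n) (joukowski w))"
proof -
  have "B \<ge> 1" using b(2)[of N] b(3)[of N 0] by simp
  define F where "F i w = poly (L (i + N)) (joukowski w) / poly (P (i + N)) (joukowski w)" for i w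
  have L_le: "cmod (poly (L n) (joukowski w)) \<le> B * (\<Sum>j\<le>m. growth_bound w ^ j) * cmod (poly (P n) (joukowski w))"
    if "w \<in> punctured_disc" "n \<ge> N" for n w
    using norm_P_sum_le[OF that(1), where n = n and J = "{..m}" and b = "b n" and B = B] b(3)[OF that(2)] that \<open>N > m\<close>
    by (simp add: b(1)[OF that(2)] poly_sum)
  \<comment> \<open>The at most m tail terms are each bounded by B times the growth bound, so
    together they take away at most half of the leading term.\<close>
  obtain w0 where w0: "w0 \<in> punctured_disc" "growth_bound w0 \<le> 1" "B * (m + 1) * growth_bound w0 \<le> 1 / 2"
    using growth_bound_small[of "B * (m + 1)"] \<open>B \<ge> 1\<close> by auto
  have "\<exists>d>0. \<forall>i. \<forall>w\<in>K. d \<le> cmod (F i w)"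
  proof (rule nonvanishing_family_bounded_below[of punctured_disc _ w0 "1 / 2", OF _ _ _ _ _ w0(1) _ _ K])
    show "open punctured_disc" by (intro open_delete open_ball)
    show "connected punctured_disc" by (intro connected_punctured_ball) simp
    show "F i holomorphic_on punctured_disc" for i
      unfolding F_def[abs_def] by (intro holomorphic_intros P_nonzero) auto
    show "F i w \<noteq> 0" if w: "w \<in> punctured_disc" for i w
    proof -
      have "poly (L (i + N)) (joukowski w) \<noteq> 0"
        using mu.zeros_in_interval[of "L (i + N)" "i + N" "joukowski w"] L[of "i + N"]
          joukowski_notin_interval[OF w] \<open>N > m\<close> by auto
      then show ?thesis using P_nonzero[OF w] by (simp add: F_def)
    qed
    show "\<exists>C. \<forall>i. \<forall>w\<in>D. cmod (F i w) \<le> C" if D: "compact D" "D \<subseteq> punctured_disc" for D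
    proof -
      obtain C where C: "\<And>w. w \<in> D \<Longrightarrow> growth_bound w \<le> C"
        using growth_bound_bounded[of D] D by (metis Diff_subset order_trans)
      have "cmod (F i w) \<le> B * (\<Sum>j\<le>m. C ^ j)" if w: "w \<in> D" for i w
      proof -
        have wS: "w \<in> punctured_disc" using w D by blast
        have "cmod (F i w) \<le> B * (\<Sum>j\<le>m. growth_bound w ^ j)"
          using L_le[OF wS, of "i + N"] P_nonzero[OF wS] by (simp add: F_def norm_divide divide_le_eq)
        also have "\<dots> \<le> B * (\<Sum>j\<le>m. C ^ j)"
          using \<open>B \<ge> 1\<close> C[OF w] growth_bound_nonneg by (intro mult_left_mono sum_mono power_mono) auto
        finally show ?thesis .
      qed
      then show ?thesis by blast
    qed
    show "1 / 2 \<le> cmod (F i w0)" for i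
    proof -
      define n where "n = i + N"
      have n: "n \<ge> N" by (simp add: n_def)
      let ?p = "\<lambda>j. poly (P (n - j)) (joukowski w0)"
      have "poly (L n) (joukowski w0) = (\<Sum>j\<le>m. b n j * ?p j)"
        by (simp add: b(1)[OF n] poly_sum)
      also have "\<dots> = ?p 0 + (\<Sum>j\<in>{1..m}. b n j * ?p j)"
        by (subst sum.atMost_shift) (simp add: b(2)[OF n] sum.atLeast1_atMost_eq lessThan_atLeast0)
      finally have e: "poly (L n) (joukowski w0) = ?p 0 + (\<Sum>j\<in>{1..m}. b n j * ?p j)" .
      have "(\<Sum>j\<in>{1..m}. growth_bound w0 ^ j) \<le> (\<Sum>j\<in>{1..m}. growth_bound w0)"
      proof (rule sum_mono)
        fix j assume "j \<in> {1..m}"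
        then show "growth_bound w0 ^ j \<le> growth_bound w0"
          using power_decreasing[of 1 j "growth_bound w0"] w0(2) growth_bound_nonneg by auto
      qed
      also have "\<dots> \<le> (m + 1) * growth_bound w0"
        using growth_bound_nonneg[of w0] by (simp add: distrib_right)
      finally have "B * (\<Sum>j\<in>{1..m}. growth_bound w0 ^ j) \<le> B * ((m + 1) * growth_bound w0)"
        using \<open>B \<ge> 1\<close> by (intro mult_left_mono) auto
      then have "B * (\<Sum>j\<in>{1..m}. growth_bound w0 ^ j) \<le> 1 / 2"
        using w0(3) by (simp add: mult.assoc)
      then have "B * (\<Sum>j\<in>{1..m}. growth_bound w0 ^ j) * cmod (?p 0) \<le> 1 / 2 * cmod (?p 0)"
        by (rule mult_right_mono) simp
      moreover have "cmod (\<Sum>j\<in>{1..m}. b n j * ?p j) \<le> B * (\<Sum>j\<in>{1..m}. growth_bound w0 ^ j) * cmod (?p 0)"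
        using norm_P_sum_le[OF w0(1), where n = n and J = "{1..m}" and b = "b n" and B = B] b(3)[OF n] n \<open>N > m\<close> by simp
      ultimately have "cmod (\<Sum>j\<in>{1..m}. b n j * ?p j) \<le> 1 / 2 * cmod (?p 0)" by linarith
      moreover have "cmod (?p 0) - cmod (\<Sum>j\<in>{1..m}. b n j * ?p j) \<le> cmod (poly (L n) (joukowski w0))"
        unfolding e by (rule norm_diff_ineq)
      ultimately have "1 / 2 * cmod (?p 0) \<le> cmod (poly (L n) (joukowski w0))" by linarith
      then show ?thesis
        using P_nonzero[OF w0(1), of n] by (simp add: F_def norm_divide le_divide_eq flip: n_def)
    qed
  qed simp
  then obtain d where d: "d > 0" "\<And>i w. w \<in> K \<Longrightarrow> d \<le> cmod (F i w)" by blast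
  have "d * cmod (poly (P n) (joukowski w)) \<le> cmod (poly (L n) (joukowski w))" if "n \<ge> N" "w \<in> K" for n w
    using d(2)[of w "n - N"] that K P_nonzero[of w n] by (simp add: F_def norm_divide le_divide_eq subset_iff)
  then show ?thesis using d(1) by blast
qed

end

section \<open>Zeros\<close>

text \<open>The real point R/2 has focal sum R; the modulus of its preimage is the required
  radius.\<close>

lemma joukowski_radius:
  fixes R :: real
  assumes "R > 2"
  obtains r where "0 < r" "r < 1" "r + inverse r = R"
proof -
  obtain w where w: "w \<noteq> 0" "cmod w \<le> 1" "joukowski w = of_real (R / 2)" by (rule joukowski_preimage)
  have "focal_sum (of_real (R / 2)) = cmod (of_real (R / 2 - 1)) + cmod (of_real (R / 2 + 1))"
    by (simp add: focal_sum_def)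
  then have "cmod w + inverse (cmod w) = R"
    using focal_sum_joukowski[OF w(1)] w(3) assms unfolding norm_of_real by simp
  moreover have "cmod w \<noteq> 1" using calculation assms by auto
  ultimately show ?thesis using that[of "cmod w"] w by simp
qed

section \<open>Two-sided comparison with the Jacobi polynomials and separation of values\<close>

context jacobi_quotient
begin

text \<open>L_n is comparable with P_n from both sides on \<open>K\<close>. Since
  \<open>lam n / lam (n - j)\<close> tends to 1, replacing L_n by its primitive changes the values
  by at most half of the lower bound.\<close>

lemma primitive_asymptotics:
  fixes Q :: "nat \<Rightarrow> complex poly"
  assumes Q: "\<And>n. n > m \<Longrightarrow> is_monic_orthogonal_wrt_op (jacobi_op \<alpha> \<beta>) \<mu> n (Q n)"
    and K: "compact K" "K \<subseteq> punctured_disc"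
  obtains q d C where "d > 0" "C > 0"
    "\<forall>\<^sub>F n in sequentially. \<forall>u v. poly (Q n) u - poly (Q n) v = poly (q n) u - poly (q n) v"
    "\<forall>\<^sub>F n in sequentially. \<forall>w\<in>K. d * cmod (poly (P n) (joukowski w)) \<le> cmod (poly (q n) (joukowski w)) \<and>
       cmod (poly (q n) (joukowski w)) \<le> C * cmod (poly (P n) (joukowski w))"
proof -
  define L where "L n = smult (- inverse (of_real (lam n))) (jacobi_op \<alpha> \<beta> (Q n))" for n
  have L: "monic_of_degree n (L n)" "mu.orth n (L n)" "jacobi_op \<alpha> \<beta> (Q n) = smult (- of_real (lam n)) (L n)"
    if "n > m" for n
    using monic_orthogonal_image[OF Q[OF that]] that by (auto simp: L_def)
  obtain B where B: "B > 0"
    "\<forall>\<^sub>F n in sequentially. \<forall>L. monic_of_degree n L \<longrightarrow> mu.orth n L \<longrightarrow>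
      (\<exists>b. L = (\<Sum>j\<le>m. smult (b j) (P (n - j))) \<and> b 0 = 1 \<and> (\<forall>j\<le>m. cmod (b j) \<le> B))"
    by (rule orthogonal_expansion_bounded)
  have "\<forall>\<^sub>F n in sequentially. n > m \<and>
      (\<exists>b. L n = (\<Sum>j\<le>m. smult (b j) (P (n - j))) \<and> b 0 = 1 \<and> (\<forall>j\<le>m. cmod (b j) \<le> B))"
    using B(2) eventually_gt_at_top[of m]
  proof eventually_elim
    case (elim n)
    then show ?case using L(1,2)[OF elim(2)] by blast
  qed
  then obtain N where N: "\<And>n. n \<ge> N \<Longrightarrow> n > m \<and>
      (\<exists>b. L n = (\<Sum>j\<le>m. smult (b j) (P (n - j))) \<and> b 0 = 1 \<and> (\<forall>j\<le>m. cmod (b j) \<le> B))"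
    unfolding eventually_sequentially by blast
  have "\<forall>n. \<exists>b. n \<ge> N \<longrightarrow> L n = (\<Sum>j\<le>m. smult (b j) (P (n - j))) \<and> b 0 = 1 \<and> (\<forall>j\<le>m. cmod (b j) \<le> B)"
    using N by blast
  then obtain b where "\<forall>n. n \<ge> N \<longrightarrow> L n = (\<Sum>j\<le>m. smult (b n j) (P (n - j))) \<and> b n 0 = 1 \<and> (\<forall>j\<le>m. cmod (b n j) \<le> B)"
    by metis
  then have b: "\<And>n. n \<ge> N \<Longrightarrow> L n = (\<Sum>j\<le>m. smult (b n j) (P (n - j)))"
    "\<And>n. n \<ge> N \<Longrightarrow> b n 0 = 1" "\<And>n j. n \<ge> N \<Longrightarrow> j \<le> m \<Longrightarrow> cmod (b n j) \<le> B"
    by auto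
  have "N > m" using N[of N] by simp
  have "\<exists>d>0. \<forall>n\<ge>N. \<forall>w\<in>K. d * cmod (poly (P n) (joukowski w)) \<le> cmod (poly (L n) (joukowski w))"
    by (rule orthogonal_bounded_below[OF _ b \<open>N > m\<close> K]) (use L N in auto)
  then obtain d where d: "d > 0"
    "\<And>n w. n \<ge> N \<Longrightarrow> w \<in> K \<Longrightarrow> d * cmod (poly (P n) (joukowski w)) \<le> cmod (poly (L n) (joukowski w))"
    by auto
  obtain H where H: "\<And>w. w \<in> K \<Longrightarrow> growth_bound w \<le> H"
    using growth_bound_bounded[of K] K by (metis Diff_subset order_trans)
  \<comment> \<open>The maximum with 0 guards against an empty \<open>K\<close>, for which
    \<open>H\<close> is arbitrary.\<close>
  define S where "S = (\<Sum>j\<le>m. max H 0 ^ j)"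
  have gS: "(\<Sum>j\<le>m. growth_bound w ^ j) \<le> S" if "w \<in> K" for w
    unfolding S_def using H[OF that] growth_bound_nonneg by (intro sum_mono power_mono) auto
  have "S \<ge> 0" unfolding S_def by (intro sum_nonneg) auto
  \<comment> \<open>Chosen so that the perturbation \<epsilon> B S is at most d/2; the added 1 keeps
    the denominator positive.\<close>
  define \<epsilon> where "\<epsilon> = d / (2 * (B * S + 1))"
  have BS: "B * S \<ge> 0" using B(1) \<open>S \<ge> 0\<close> by simp
  have \<epsilon>: "\<epsilon> > 0" "\<epsilon> * (B * S) \<le> d / 2"
    using d(1) BS by (auto simp: \<epsilon>_def field_simps)
  define q where "q n = primitive n (b n)" for n
  have "\<forall>\<^sub>F n in sequentially. \<forall>u v. poly (Q n) u - poly (Q n) v = poly (q n) u - poly (q n) v"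
    using eventually_ge_at_top[of N]
  proof eventually_elim
    case (elim n)
    then have "n > m" using \<open>N > m\<close> by simp
    then show ?case
      unfolding q_def using poly_diff_primitive[of "Q n" n "b n"] L(3)[of n] b(1)[OF elim] by simp
  qed
  moreover
  have "\<forall>\<^sub>F n in sequentially. \<forall>j\<in>{..m}. \<bar>lam n / lam (n - j) - 1\<bar> < \<epsilon>"
  proof (intro eventually_ball_finite ballI finite_atMost)
    fix j
    show "\<forall>\<^sub>F n in sequentially. \<bar>lam n / lam (n - j) - 1\<bar> < \<epsilon>"
      using tendstoD[OF lam_quotient_tendsto[of j] \<epsilon>(1)] by (simp add: dist_real_def)
  qed
  then have "\<forall>\<^sub>F n in sequentially. \<forall>w\<in>K. d / 2 * cmod (poly (P n) (joukowski w)) \<le> cmod (poly (q n) (joukowski w)) \<and>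
       cmod (poly (q n) (joukowski w)) \<le> (B * S + d / 2) * cmod (poly (P n) (joukowski w))"
    using eventually_ge_at_top[of N]
  proof eventually_elim
    case (elim n)
    show ?case
    proof
      fix w assume w: "w \<in> K"
      then have wS: "w \<in> punctured_disc" using K by blast
      define p where "p = cmod (poly (P n) (joukowski w))"
      have "p \<ge> 0" by (simp add: p_def)
      have "m \<le> n" using elim(2) \<open>N > m\<close> by simp
      define c where "c j = of_real (lam n / lam (n - j) - 1) * b n j" for j
      have c: "cmod (c j) \<le> \<epsilon> * B" if "j \<le> m" for j
        unfolding c_def norm_mult norm_of_real using elim(1) that b(3)[OF elim(2) that] \<epsilon>(1)
        by (intro mult_mono) (auto intro: less_imp_le)
      have "poly (q n) (joukowski w) - poly (L n) (joukowski w) = (\<Sum>j\<le>m. c j * poly (P (n - j)) (joukowski w))"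
        by (simp add: q_def primitive_def b(1)[OF elim(2)] poly_sum c_def algebra_simps flip: sum_subtractf)
      also have "cmod \<dots> \<le> \<epsilon> * B * (\<Sum>j\<le>m. growth_bound w ^ j) * p"
        unfolding p_def by (rule norm_P_sum_le[OF wS \<open>m \<le> n\<close>]) (use c in auto)
      also have "\<dots> \<le> \<epsilon> * B * S * p"
        using \<epsilon> B \<open>p \<ge> 0\<close> gS[OF w] by (intro mult_right_mono mult_left_mono) auto
      also have "\<dots> \<le> d / 2 * p"
        using \<epsilon>(2) \<open>p \<ge> 0\<close> by (intro mult_right_mono) (auto simp: mult.assoc)
      finally have diff: "cmod (poly (q n) (joukowski w) - poly (L n) (joukowski w)) \<le> d / 2 * p" .
      have low: "d * p \<le> cmod (poly (L n) (joukowski w))"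
        unfolding p_def by (rule d(2)[OF elim(2) w])
      have "cmod (poly (L n) (joukowski w)) = cmod (\<Sum>j\<le>m. b n j * poly (P (n - j)) (joukowski w))"
        by (simp add: b(1)[OF elim(2)] poly_sum)
      also have "\<dots> \<le> B * (\<Sum>j\<le>m. growth_bound w ^ j) * p"
        unfolding p_def by (rule norm_P_sum_le[OF wS \<open>m \<le> n\<close>]) (use b(3)[OF elim(2)] in auto)
      also have "\<dots> \<le> B * S * p"
        using B \<open>p \<ge> 0\<close> gS[OF w] by (intro mult_right_mono mult_left_mono) auto
      finally have up: "cmod (poly (L n) (joukowski w)) \<le> B * S * p" .
      have t1: "cmod (poly (q n) (joukowski w)) \<le> cmod (poly (L n) (joukowski w)) +
           cmod (poly (q n) (joukowski w) - poly (L n) (joukowski w))"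
        by (rule norm_triangle_sub)
      have t2: "cmod (poly (L n) (joukowski w)) \<le> cmod (poly (q n) (joukowski w)) +
           cmod (poly (q n) (joukowski w) - poly (L n) (joukowski w))"
        using norm_triangle_sub[of "poly (L n) (joukowski w)" "poly (q n) (joukowski w)"]
        by (simp add: norm_minus_commute)
      have e1: "(B * S + d / 2) * p = B * S * p + d / 2 * p" by (rule distrib_right)
      have e2: "d * p = d / 2 * p + d / 2 * p" by simp
      show "d / 2 * cmod (poly (P n) (joukowski w)) \<le> cmod (poly (q n) (joukowski w)) \<and>
         cmod (poly (q n) (joukowski w)) \<le> (B * S + d / 2) * cmod (poly (P n) (joukowski w))"
        unfolding p_def[symmetric] e1 using t1 t2 e2 diff low up by linarith
    qed
  qed
  moreover have "d / 2 > 0" "B * S + d / 2 > 0" using d(1) BS by auto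
  ultimately show ?thesis using that by blast
qed

text \<open>The primitive has modulus at most C |P_n| on the ellipse R1, hence inside it by the
  maximum principle, and at least d |P_n| beyond R2, where |P_n| is larger by any prescribed factor.
  The bound R3 keeps u in a compact annulus, away from w = 0.\<close>

lemma eventually_distinct_values:
  fixes Q :: "nat \<Rightarrow> complex poly"
  assumes Q: "\<And>n. n > m \<Longrightarrow> is_monic_orthogonal_wrt_op (jacobi_op \<alpha> \<beta>) \<mu> n (Q n)"
    and R: "2 < R1" "R1 < R2" "R2 < R3"
  shows "\<forall>\<^sub>F n in sequentially. \<forall>u v. focal_sum v < R1 \<longrightarrow> R2 < focal_sum u \<longrightarrow> focal_sum u < R3 \<longrightarrow>
    poly (Q n) u \<noteq> poly (Q n) v"
proof -
  obtain r1 where r1: "0 < r1" "r1 < 1" "r1 + inverse r1 = R1" using joukowski_radius R by auto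
  obtain r2 where r2: "0 < r2" "r2 < 1" "r2 + inverse r2 = R2" using joukowski_radius[of R2] R by auto
  obtain r3 where r3: "0 < r3" "r3 < 1" "r3 + inverse r3 = R3" using joukowski_radius[of R3] R by auto
  have r: "r2 < r1" "r3 < r2"
    using add_inverse_less_iff[of r2 r1] add_inverse_less_iff[of r3 r2] r1 r2 r3 R by auto
  define K where "K = cball 0 r1 - ball (0::complex) r3"
  have K: "compact K" "K \<subseteq> punctured_disc"
    using r1 r2 r3 by (auto simp: K_def compact_diff)
  obtain q d C where q: "d > 0" "C > 0"
    "\<forall>\<^sub>F n in sequentially. \<forall>u v. poly (Q n) u - poly (Q n) v = poly (q n) u - poly (q n) v"
    "\<forall>\<^sub>F n in sequentially. \<forall>w\<in>K. d * cmod (poly (P n) (joukowski w)) \<le> cmod (poly (q n) (joukowski w)) \<and>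
       cmod (poly (q n) (joukowski w)) \<le> C * cmod (poly (P n) (joukowski w))"
    by (rule primitive_asymptotics[OF Q K])
  \<comment> \<open>The factor 2 C / d turns the upper bound on the inner ellipse into half of the
    lower bound at the outer point.\<close>
  have "\<forall>\<^sub>F n in sequentially. \<forall>w w'. cmod w = r1 \<longrightarrow> r3 \<le> cmod w' \<longrightarrow> cmod w' \<le> r2 \<longrightarrow>
     2 * C / d * cmod (poly (P n) (joukowski w)) \<le> cmod (poly (P n) (joukowski w'))"
    by (rule P_geometric_growth) (use r r1 r3 in auto)
  with q(3,4) show ?thesis
  proof eventually_elim
    case (elim n)
    show ?case
    proof (intro allI impI)
      fix u v assume uv: "focal_sum v < R1" "R2 < focal_sum u" "focal_sum u < R3"
      obtain w' where w': "w' \<noteq> 0" "cmod w' \<le> 1" "joukowski w' = u" by (rule joukowski_preimage)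
      have fu: "focal_sum u = cmod w' + inverse (cmod w')" using focal_sum_joukowski w' by blast
      have w'r: "r3 < cmod w'" "cmod w' < r2"
        using add_inverse_less_iff[of r3 "cmod w'"] add_inverse_less_iff[of "cmod w'" r2] uv fu w' r2 r3 by auto
      define p where "p = cmod (poly (P n) (joukowski w'))"
      have "w' \<in> K" using w'r r by (auto simp: K_def)
      then have "w' \<in> punctured_disc" using K by blast
      then have "p > 0" using P_nonzero[of w' n] by (simp add: p_def)
      have "cmod (poly (q n) v) \<le> d / 2 * p"
      proof (rule poly_norm_le_on_ellipse[OF _ uv(1)])
        fix z assume z: "focal_sum z = R1"
        obtain w where w: "w \<noteq> 0" "cmod w \<le> 1" "joukowski w = z" by (rule joukowski_preimage)
        have "cmod w + inverse (cmod w) = r1 + inverse r1"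
          using focal_sum_joukowski[OF w(1)] w(3) z r1(3) by simp
        moreover have "0 < cmod w" using w(1) by simp
        ultimately have wr: "cmod w = r1"
          using add_inverse_inj w(2) r1(1,2) less_imp_le by blast
        then have "w \<in> K" using r by (auto simp: K_def)
        then have "cmod (poly (q n) z) \<le> C * cmod (poly (P n) (joukowski w))"
          using elim(2) w(3) by blast
        also have "\<dots> \<le> d / 2 * p"
        proof -
          have "2 * C / d * cmod (poly (P n) (joukowski w)) \<le> p"
            unfolding p_def using elim(3) wr w'r by auto
          then show ?thesis using q(1) by (simp add: field_simps)
        qed
        finally show "cmod (poly (q n) z) \<le> d / 2 * p" .
      qed
      also have "\<dots> < d * p" using \<open>p > 0\<close> q(1) by simp
      also have "\<dots> \<le> cmod (poly (q n) u)" using elim(2) \<open>w' \<in> K\<close> w'(3) by (auto simp: p_def)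
      finally have "poly (q n) u \<noteq> poly (q n) v" by auto
      then have "poly (q n) u - poly (q n) v \<noteq> 0" by simp
      then show "poly (Q n) u \<noteq> poly (Q n) v" using elim(1)[rule_format, of u v] by auto
    qed
  qed
qed

end

text \<open>A zero w of \<open>Q n\<close> satisfies Q_n(w) = Q_n(\<zeta>_n). If the focal sums of z
  and \<zeta> differ, confocal ellipses separate neighbourhoods of the two points, and
  \<open>eventually_distinct_values\<close> rules out such equalities for large n.\<close>

theorem zero_accumulation_points_subset_ellipse:
  fixes \<alpha> \<beta> :: real and m :: nat and \<mu> :: "real measure"
    and \<zeta>s :: "nat \<Rightarrow> complex" and \<zeta> :: complex and Q :: "nat \<Rightarrow> complex poly"
  assumes "\<alpha> > -1" and "\<beta> > -1"
    and "\<mu> \<in> jacobi_class m \<alpha> \<beta>"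
    and \<zeta>: "\<zeta>s \<longlonglongrightarrow> \<zeta>" "\<zeta> \<notin> complex_of_real ` {-1..1}"
    and Q: "\<And>n. n > m \<Longrightarrow> is_monic_orthogonal_wrt_op (jacobi_op \<alpha> \<beta>) \<mu> n (Q n)"
    and Q0: "\<And>n. n > m \<Longrightarrow> poly (Q n) (\<zeta>s n) = 0"
  shows "zero_accumulation_points m Q \<subseteq> zeta_ellipse \<zeta>"
proof
  fix z assume "z \<in> zero_accumulation_points m Q"
  then have acc: "infinite {n. n > m \<and> (\<exists>w\<in>U. poly (Q n) w = 0)}" if "open U" "z \<in> U" for U
    using that by (auto simp: zero_accumulation_points_def)
  obtain \<rho> where \<rho>: "\<rho> \<noteq> 0" "degree \<rho> = m" "\<forall>x\<in>{-1..1}. poly \<rho> x \<ge> 0"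
    "\<mu> = density (jacobi_measure \<alpha> \<beta>) (\<lambda>x. ennreal (1 / poly \<rho> x))" and "finite_measure \<mu>"
    using assms(3) by (auto simp: jacobi_class_def)
  then interpret jacobi_quotient \<alpha> \<beta> \<rho>
    using assms(1,2) by (intro jacobi_quotient.intro) auto
  have m: "jacobi_quotient.m \<rho> = m" using \<rho>(2) by (simp add: m_def)
  have distinct: "\<forall>\<^sub>F n in sequentially. \<forall>u v. focal_sum v < R1 \<longrightarrow> R2 < focal_sum u \<longrightarrow> focal_sum u < R3 \<longrightarrow>
    poly (Q n) u \<noteq> poly (Q n) v" if "2 < R1" "R1 < R2" "R2 < R3" for R1 R2 R3
    by (rule eventually_distinct_values[OF _ that]) (use Q m \<rho>(4) in auto)
  have f\<zeta>: "(\<lambda>n. focal_sum (\<zeta>s n)) \<longlonglongrightarrow> focal_sum \<zeta>"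
    unfolding focal_sum_def by (intro tendsto_intros \<zeta>)
  have gt2: "focal_sum \<zeta> > 2" by (rule focal_sum_gt_2[OF \<zeta>(2)])
  have infinite_imp: False
    if U: "open U" "z \<in> U" "\<forall>\<^sub>F n in sequentially. \<forall>w\<in>U. poly (Q n) w \<noteq> poly (Q n) (\<zeta>s n)" for U
  proof -
    obtain N where N: "\<And>n w. n \<ge> N \<Longrightarrow> w \<in> U \<Longrightarrow> poly (Q n) w \<noteq> poly (Q n) (\<zeta>s n)"
      using U(3) by (auto simp: eventually_sequentially)
    have "{n. n > m \<and> (\<exists>w\<in>U. poly (Q n) w = 0)} \<subseteq> {..<N}"
      using N Q0 by (force simp: not_less[symmetric])
    then show False using acc[OF U(1,2)] finite_subset by blast
  qed
  have "focal_sum z = focal_sum \<zeta>"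
  proof (cases "focal_sum z" "focal_sum \<zeta>" rule: linorder_cases)
    case less
    \<comment> \<open>The maximum with 2 ensures R1 > 2 also when z lies on [-1,1], where the focal
      sum is exactly 2.\<close>
    define R1 where "R1 = (max 2 (focal_sum z) + focal_sum \<zeta>) / 2"
    define R2 where "R2 = (R1 + focal_sum \<zeta>) / 2"
    define R3 where "R3 = focal_sum \<zeta> + 1"
    have R: "2 < R1" "focal_sum z < R1" "R1 < R2" "R2 < focal_sum \<zeta>" "focal_sum \<zeta> < R3" "R2 < R3"
      using less gt2 by (auto simp: R1_def R2_def R3_def)
    have "\<forall>\<^sub>F n in sequentially. \<forall>w\<in>{w. focal_sum w < R1}. poly (Q n) w \<noteq> poly (Q n) (\<zeta>s n)"
      using distinct[OF R(1,3,6)] order_tendstoD(1)[OF f\<zeta> R(4)] order_tendstoD(2)[OF f\<zeta> R(5)]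
      by eventually_elim force
    moreover have "open {w. focal_sum w < R1}" by (intro open_Collect_less continuous_intros)
    ultimately show ?thesis using infinite_imp R by blast
  next
    case greater
    \<comment> \<open>The roles are exchanged: the zeros near z are now the outer points, so their
      neighbourhood is cut off at R3, and the inner points \<open>\<zeta>s n\<close> eventually lie
      inside R1.\<close>
    define R1 where "R1 = (2 * focal_sum \<zeta> + focal_sum z) / 3"
    define R2 where "R2 = (focal_sum \<zeta> + 2 * focal_sum z) / 3"
    define R3 where "R3 = focal_sum z + 1"
    have R: "2 < R1" "focal_sum \<zeta> < R1" "R1 < R2" "R2 < focal_sum z" "focal_sum z < R3" "R2 < R3"
      using greater gt2 by (auto simp: R1_def R2_def R3_def)
    have "\<forall>\<^sub>F n in sequentially. \<forall>w\<in>{w. R2 < focal_sum w} \<inter> {w. focal_sum w < R3}. poly (Q n) w \<noteq> poly (Q n) (\<zeta>s n)"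
      using distinct[OF R(1,3,6)] order_tendstoD(2)[OF f\<zeta> R(2)]
      by eventually_elim force
    moreover have "open ({w. R2 < focal_sum w} \<inter> {w. focal_sum w < R3})"
      by (intro open_Int open_Collect_less continuous_intros)
    ultimately show ?thesis using infinite_imp R by blast
  qed
  then show "z \<in> zeta_ellipse \<zeta>" by (rule mem_zeta_ellipse[OF \<zeta>(2)])
qed

theorem theorem1p1:
  fixes \<alpha> \<beta> :: real and m :: nat and \<mu> :: "real measure"
    and \<zeta>s :: "nat \<Rightarrow> complex" and \<zeta> :: complex and Q :: "nat \<Rightarrow> complex poly"
  assumes "\<alpha> > -1" and "\<beta> > -1" and "m > 0"
    and "\<mu> \<in> jacobi_class m \<alpha> \<beta>"
    and "\<zeta>s \<longlonglongrightarrow> \<zeta>" and "\<zeta> \<notin> complex_of_real ` {-1..1}"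
    and "\<And>n. n > m \<Longrightarrow> is_monic_orthogonal_wrt_op (jacobi_op \<alpha> \<beta>) \<mu> n (Q n)"
    and "\<And>n. n > m \<Longrightarrow> poly (Q n) (\<zeta>s n) = 0"
  shows "zero_accumulation_points m Q \<subseteq> zeta_ellipse \<zeta> \<union> complex_of_real ` {-1..1} \<and>
         ((INF x\<in>{-1..1}. cmod (\<zeta> - complex_of_real x)) > 2 \<longrightarrow>
            zero_accumulation_points m Q \<subseteq> zeta_ellipse \<zeta>)"
  using zero_accumulation_points_subset_ellipse[OF assms(1,2,4-8)] by blast

end
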